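(* Given a ring $R$, a positive integer $n$, a ring homomorphism $\sigma\colon R\to M_n(R)$ and a right $\sigma$-derivation $\delta\colon R\to R^n$, the $(\sigma,\delta)$-free skew extension $R\langle x_1,\dots,x_n;\sigma,\delta\rangle$ is isomorphic, as an $R$-ring, to the universal $R$-ring $U(M,\iota)$, where $M$ is a rank $1$ bimodule extension of a free right $R$-module of rank $n$ and $\iota\colon R\to M$ is the inclusion map.
   Context: Rings are associative with identity element; ring homomorphisms preserve the identity; modules are unital. An $R$-ring is a ring $A$ together with a ring homomorphism $\lambda_A\colon R\to A$; it is an $R$-bimodule via $ra=\lambda_A(r)a$, $ar=a\lambda_A(r)$, and in expressions inside $A$ an element $r\in R$ stands for $\lambda_A(r)$. An $R$-ring homomorphism $\varphi\colon A\to B$ is a ring homomorphism with $\varphi\lambda_A=\lambda_B$. $R^n$ denotes row vectors with $n$ entries in $R$. For a ring homomorphism $\sigma\colon R\to M_n(R)$, a right $\sigma$-derivation is an additive map $\delta\colon R\to R^n$ with $\delta(rs)=\delta(r)\sigma(s)+r\delta(s)$ for all $r,s\in R$ (matrix product in the first term). Write $\sigma_{ij}(r)$ for the $(i,j)$-entry of $\sigma(r)$ and $\delta_j(r)$ for the $j$-th component of $\delta(r)$. The $(\sigma,\delta)$-free skew extension $R\langle x_1,\dots,x_n;\sigma,\delta\rangle$ of $R$ is an $R$-ring $S$ (unique up to $R$-ring isomorphism fixing generators) containing an $n$-element subset $X=\{x_1,\dots,x_n\}$ such that (i) the submonoid $\langle X\rangle$ of the multiplicative monoid of $S$ generated by $X$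 is free on $X$; (ii) $S$ is a free right $R$-module with basis $\langle X\rangle$; (iii) $rx_j=\sum_{i=1}^n x_i\sigma_{ij}(r)+\delta_j(r)$ for all $j=1,\dots,n$ and $r\in R$. For a right $R$-module $V$, $\operatorname{End}(V_R)$ is the ring of right $R$-module endomorphisms (product is composition), and $\operatorname{Hom}(V_R,R_R)$ is a left $R$-module via $(rf)(v)=rf(v)$. Given a ring homomorphism $\tau\colon R\to\operatorname{End}(V_R)$, a $\tau$-derivation is an additive map $d\colon R\to\operatorname{Hom}(V_R,R_R)$ with $d(rs)=d(r)\tau(s)+rd(s)$ for all $r,s\in R$. The rank $1$ bimodule extension of $V$ defined by $\tau$ and $d$ is the right $R$-module $M=R\oplus V$ with left $R$-action $r(s+v)=rs+d(r)(v)+\tau(r)(v)$ for $r,s\in R$, $v\in V$; this is an $R$-bimodule in which $R$ is a sub-bimodule. For an $R$-bimodule $M$ and an $R$-bimodule map $\xi\colon R\to M$, the universal $R$-ring on $M$ along $\xi$, denoted $U(M,\xi)$, is an $R$-ring $(U,\lambda_U)$ with an $R$-bimodule map $j\colon M\to U$ satisfying $j\xi=\lambda_U$, such that for any $R$-ring $(A,\lambda_A)$ and any $R$-bimodule map $f\colon M\to A$ with $f\xi=\lambda_A$ there is a unique $R$-ring homomorphism $\varphi\colon U\to A$ with $\varphi j=f$; it exists and is unique up to $R$-ring isomorphism. *)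

theory Defs
  imports "HOL-Algebra.QuotRing" "HOL-Library.Poly_Mapping"
begin

section \<open>Modules, bimodules and R-rings over a noncommutative ring\<close>

text \<open>The additive group of a module is carried by the fields \<open>carrier\<close>, \<open>zero\<close> and \<open>add\<close> of
  the library's ring record; as for the library's own module record, the fields \<open>mult\<close> and
  \<open>one\<close> inherited from it have no meaning for a module.\<close>

record ('r, 'v) rmodule = "'v ring" +
  rsmult :: "'v \<Rightarrow> 'r \<Rightarrow> 'v"

record ('r, 'v) bimod = "('r, 'v) rmodule" +
  lsmult :: "'r \<Rightarrow> 'v \<Rightarrow> 'v"

locale right_module = R: ring R + V: abelian_group V
  for R :: "('r, 'k) ring_scheme" (structure) and V :: "('r, 'v, 'l) rmodule_scheme" +
  assumes rsmult_closed:
      "\<lbrakk>v \<in> carrier V; r \<in> carrier R\<rbrakk> \<Longrightarrow> rsmult V v r \<in> carrier V"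
    and rsmult_add:
      "\<lbrakk>v \<in> carrier V; w \<in> carrier V; r \<in> carrier R\<rbrakk>
        \<Longrightarrow> rsmult V (v \<oplus>\<^bsub>V\<^esub> w) r = rsmult V v r \<oplus>\<^bsub>V\<^esub> rsmult V w r"
    and rsmult_radd:
      "\<lbrakk>v \<in> carrier V; r \<in> carrier R; s \<in> carrier R\<rbrakk>
        \<Longrightarrow> rsmult V v (r \<oplus> s) = rsmult V v r \<oplus>\<^bsub>V\<^esub> rsmult V v s"
    and rsmult_assoc:
      "\<lbrakk>v \<in> carrier V; r \<in> carrier R; s \<in> carrier R\<rbrakk>
        \<Longrightarrow> rsmult V v (r \<otimes> s) = rsmult V (rsmult V v r) s"
    and rsmult_one:
      "v \<in> carrier V \<Longrightarrow> rsmult V v \<one> = v"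

locale bimodule = right_module R M
  for R :: "('r, 'k) ring_scheme" (structure) and M :: "('r, 'v, 'l) bimod_scheme" +
  assumes lsmult_closed:
      "\<lbrakk>r \<in> carrier R; m \<in> carrier M\<rbrakk> \<Longrightarrow> lsmult M r m \<in> carrier M"
    and lsmult_add:
      "\<lbrakk>r \<in> carrier R; m \<in> carrier M; m' \<in> carrier M\<rbrakk>
        \<Longrightarrow> lsmult M r (m \<oplus>\<^bsub>M\<^esub> m') = lsmult M r m \<oplus>\<^bsub>M\<^esub> lsmult M r m'"
    and lsmult_radd:
      "\<lbrakk>r \<in> carrier R; s \<in> carrier R; m \<in> carrier M\<rbrakk>
        \<Longrightarrow> lsmult M (r \<oplus> s) m = lsmult M r m \<oplus>\<^bsub>M\<^esub> lsmult M s m"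
    and lsmult_assoc:
      "\<lbrakk>r \<in> carrier R; s \<in> carrier R; m \<in> carrier M\<rbrakk>
        \<Longrightarrow> lsmult M (r \<otimes> s) m = lsmult M r (lsmult M s m)"
    and lsmult_one:
      "m \<in> carrier M \<Longrightarrow> lsmult M \<one> m = m"
    and lsmult_rsmult:
      "\<lbrakk>r \<in> carrier R; m \<in> carrier M; s \<in> carrier R\<rbrakk>
        \<Longrightarrow> rsmult M (lsmult M r m) s = lsmult M r (rsmult M m s)"

definition rmod_hom ::
  "('r, 'k) ring_scheme \<Rightarrow> ('r, 'v, 'l) rmodule_scheme \<Rightarrow> ('r, 'w, 'p) rmodule_scheme
    \<Rightarrow> ('v \<Rightarrow> 'w) set"
  where "rmod_hom R V W = {f \<in> carrier V \<rightarrow> carrier W.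
    (\<forall>v\<in>carrier V. \<forall>w\<in>carrier V. f (v \<oplus>\<^bsub>V\<^esub> w) = f v \<oplus>\<^bsub>W\<^esub> f w) \<and>
    (\<forall>v\<in>carrier V. \<forall>r\<in>carrier R. f (rsmult V v r) = rsmult W (f v) r)}"

definition bimod_hom ::
  "('r, 'k) ring_scheme \<Rightarrow> ('r, 'v, 'l) bimod_scheme \<Rightarrow> ('r, 'w, 'p) bimod_scheme
    \<Rightarrow> ('v \<Rightarrow> 'w) set"
  where "bimod_hom R M N = {f \<in> rmod_hom R M N.
    \<forall>r\<in>carrier R. \<forall>m\<in>carrier M. f (lsmult M r m) = lsmult N r (f m)}"

locale R_ring = R: ring R + A: ring A
  for R :: "('r, 'k) ring_scheme" (structure) and A :: "('a, 'l) ring_scheme"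
    and lam :: "'r \<Rightarrow> 'a" +
  assumes lam_hom: "lam \<in> ring_hom R A"

definition ring_bimod :: "('a, 'l) ring_scheme \<Rightarrow> ('r \<Rightarrow> 'a) \<Rightarrow> ('r, 'a) bimod"
  where "ring_bimod A lam =
    \<lparr>carrier = carrier A, monoid.mult = mult A, one = one A, zero = zero A, add = add A,
     rsmult = (\<lambda>a r. a \<otimes>\<^bsub>A\<^esub> lam r), lsmult = (\<lambda>r a. lam r \<otimes>\<^bsub>A\<^esub> a)\<rparr>"

definition R_ring_hom ::
  "('r, 'k) ring_scheme \<Rightarrow> ('a, 'l) ring_scheme \<Rightarrow> ('r \<Rightarrow> 'a) \<Rightarrow> ('b, 'p) ring_scheme \<Rightarrow> ('r \<Rightarrow> 'b)
    \<Rightarrow> ('a \<Rightarrow> 'b) set"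
  where "R_ring_hom R A lamA B lamB =
    {\<phi> \<in> ring_hom A B. \<forall>r\<in>carrier R. \<phi> (lamA r) = lamB r}"

definition R_ring_isomorphic ::
  "('r, 'k) ring_scheme \<Rightarrow> ('a, 'l) ring_scheme \<Rightarrow> ('r \<Rightarrow> 'a) \<Rightarrow> ('b, 'p) ring_scheme \<Rightarrow> ('r \<Rightarrow> 'b)
    \<Rightarrow> bool"
  where "R_ring_isomorphic R A lamA B lamB \<longleftrightarrow>
    (\<exists>\<phi>\<in>R_ring_hom R A lamA B lamB. bij_betw \<phi> (carrier A) (carrier B))"

text \<open>A possibly infinite basis: the coefficient family of an element has finite support and is
  unique (coefficient families are extensional functions on \<open>B\<close>).\<close>

definition right_basis ::
  "('r, 'k) ring_scheme \<Rightarrow> ('r, 'v, 'l) rmodule_scheme \<Rightarrow> 'v set \<Rightarrow> bool"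
  where "right_basis R V B \<longleftrightarrow> B \<subseteq> carrier V \<and>
    (\<forall>v\<in>carrier V. \<exists>!c. c \<in> B \<rightarrow>\<^sub>E carrier R \<and> finite {b\<in>B. c b \<noteq> \<zero>\<^bsub>R\<^esub>} \<and>
      v = (\<Oplus>\<^bsub>V\<^esub>b\<in>{b\<in>B. c b \<noteq> \<zero>\<^bsub>R\<^esub>}. rsmult V b (c b)))"

definition free_right_module ::
  "('r, 'k) ring_scheme \<Rightarrow> ('r, 'v, 'l) rmodule_scheme \<Rightarrow> nat \<Rightarrow> bool"
  where "free_right_module R V n \<longleftrightarrow> right_module R V \<and>
    (\<exists>B. right_basis R V B \<and> finite B \<and> card B = n)"


section \<open>Free skew extensions\<close>

text \<open>Indices run over \<open>{..<n}\<close>. Matrices and rows are extensional functions, so that equality of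
  functions is equality of matrices.\<close>

definition mat_ring :: "('r, 'k) ring_scheme \<Rightarrow> nat \<Rightarrow> (nat \<Rightarrow> nat \<Rightarrow> 'r) ring"
  where "mat_ring R n =
    \<lparr>carrier = {..<n} \<rightarrow>\<^sub>E {..<n} \<rightarrow>\<^sub>E carrier R,
     monoid.mult = (\<lambda>A B. \<lambda>i\<in>{..<n}. \<lambda>j\<in>{..<n}. \<Oplus>\<^bsub>R\<^esub>k\<in>{..<n}. A i k \<otimes>\<^bsub>R\<^esub> B k j),
     one = (\<lambda>i\<in>{..<n}. \<lambda>j\<in>{..<n}. if i = j then \<one>\<^bsub>R\<^esub> else \<zero>\<^bsub>R\<^esub>),
     zero = (\<lambda>i\<in>{..<n}. \<lambda>j\<in>{..<n}. \<zero>\<^bsub>R\<^esub>),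
     add = (\<lambda>A B. \<lambda>i\<in>{..<n}. \<lambda>j\<in>{..<n}. A i j \<oplus>\<^bsub>R\<^esub> B i j)\<rparr>"

definition right_sigma_derivation ::
  "('r, 'k) ring_scheme \<Rightarrow> nat \<Rightarrow> ('r \<Rightarrow> nat \<Rightarrow> nat \<Rightarrow> 'r) \<Rightarrow> ('r \<Rightarrow> nat \<Rightarrow> 'r) \<Rightarrow> bool"
  where "right_sigma_derivation R n \<sigma> \<delta> \<longleftrightarrow>
    \<delta> \<in> carrier R \<rightarrow> ({..<n} \<rightarrow>\<^sub>E carrier R) \<and>
    (\<forall>r\<in>carrier R. \<forall>s\<in>carrier R. \<forall>j<n.
      \<delta> (r \<oplus>\<^bsub>R\<^esub> s) j = \<delta> r j \<oplus>\<^bsub>R\<^esub> \<delta> s j \<and>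
      \<delta> (r \<otimes>\<^bsub>R\<^esub> s) j = (\<Oplus>\<^bsub>R\<^esub>i\<in>{..<n}. \<delta> r i \<otimes>\<^bsub>R\<^esub> \<sigma> s i j) \<oplus>\<^bsub>R\<^esub> r \<otimes>\<^bsub>R\<^esub> \<delta> s j)"

definition word_prod :: "('a, 'k) monoid_scheme \<Rightarrow> 'a list \<Rightarrow> 'a"
  where "word_prod G ws = foldr (mult G) ws \<one>\<^bsub>G\<^esub>"

definition submonoid_generated :: "('a, 'k) monoid_scheme \<Rightarrow> 'a set \<Rightarrow> 'a set"
  where "submonoid_generated G X = \<Inter>{H. submonoid H G \<and> X \<subseteq> H}"

text \<open>The canonical map from the free monoid of words over \<open>X\<close> is bijective.\<close>

definition free_submonoid_on :: "('a, 'k) monoid_scheme \<Rightarrow> 'a set \<Rightarrow> bool"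
  where "free_submonoid_on G X \<longleftrightarrow>
    bij_betw (word_prod G) (lists X) (submonoid_generated G X)"

definition free_skew_extension ::
  "('r, 'k) ring_scheme \<Rightarrow> nat \<Rightarrow> ('r \<Rightarrow> nat \<Rightarrow> nat \<Rightarrow> 'r) \<Rightarrow> ('r \<Rightarrow> nat \<Rightarrow> 'r)
    \<Rightarrow> ('s, 'l) ring_scheme \<Rightarrow> ('r \<Rightarrow> 's) \<Rightarrow> (nat \<Rightarrow> 's) \<Rightarrow> bool"
  where "free_skew_extension R n \<sigma> \<delta> S lam x \<longleftrightarrow>
    R_ring R S lam \<and> x \<in> {..<n} \<rightarrow> carrier S \<and> inj_on x {..<n} \<and>
    free_submonoid_on S (x ` {..<n}) \<and>
    right_basis R (ring_bimod S lam) (submonoid_generated S (x ` {..<n})) \<and>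
    (\<forall>j<n. \<forall>r\<in>carrier R.
      lam r \<otimes>\<^bsub>S\<^esub> x j = (\<Oplus>\<^bsub>S\<^esub>i\<in>{..<n}. x i \<otimes>\<^bsub>S\<^esub> lam (\<sigma> r i j)) \<oplus>\<^bsub>S\<^esub> lam (\<delta> r j))"


section \<open>Rank 1 bimodule extensions\<close>

definition End_ring ::
  "('r, 'k) ring_scheme \<Rightarrow> ('r, 'v, 'l) rmodule_scheme \<Rightarrow> ('v \<Rightarrow> 'v) ring"
  where "End_ring R V =
    \<lparr>carrier = rmod_hom R V V \<inter> extensional (carrier V),
     monoid.mult = (\<lambda>f g. compose (carrier V) f g),
     one = (\<lambda>v\<in>carrier V. v),
     zero = (\<lambda>v\<in>carrier V. \<zero>\<^bsub>V\<^esub>),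
     add = (\<lambda>f g. \<lambda>v\<in>carrier V. f v \<oplus>\<^bsub>V\<^esub> g v)\<rparr>"

definition tau_derivation ::
  "('r, 'k) ring_scheme \<Rightarrow> ('r, 'v, 'l) rmodule_scheme \<Rightarrow> ('r \<Rightarrow> 'v \<Rightarrow> 'v) \<Rightarrow> ('r \<Rightarrow> 'v \<Rightarrow> 'r)
    \<Rightarrow> bool"
  where "tau_derivation R V \<tau> d \<longleftrightarrow>
    d \<in> carrier R \<rightarrow> rmod_hom R V (ring_bimod R (\<lambda>r. r)) \<and>
    (\<forall>r\<in>carrier R. \<forall>s\<in>carrier R. \<forall>v\<in>carrier V.
      d (r \<oplus>\<^bsub>R\<^esub> s) v = d r v \<oplus>\<^bsub>R\<^esub> d s v \<and>
      d (r \<otimes>\<^bsub>R\<^esub> s) v = d r (\<tau> s v) \<oplus>\<^bsub>R\<^esub> r \<otimes>\<^bsub>R\<^esub> d s v)"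

definition rank1_ext ::
  "('r, 'k) ring_scheme \<Rightarrow> ('r, 'v, 'l) rmodule_scheme \<Rightarrow> ('r \<Rightarrow> 'v \<Rightarrow> 'v) \<Rightarrow> ('r \<Rightarrow> 'v \<Rightarrow> 'r)
    \<Rightarrow> ('r, 'r \<times> 'v) bimod"
  where "rank1_ext R V \<tau> d =
    \<lparr>carrier = carrier R \<times> carrier V, monoid.mult = undefined, one = undefined,
     zero = (\<zero>\<^bsub>R\<^esub>, \<zero>\<^bsub>V\<^esub>),
     add = (\<lambda>(s, v) (s', v'). (s \<oplus>\<^bsub>R\<^esub> s', v \<oplus>\<^bsub>V\<^esub> v')),
     rsmult = (\<lambda>(s, v) r. (s \<otimes>\<^bsub>R\<^esub> r, rsmult V v r)),
     lsmult = (\<lambda>r (s, v). (r \<otimes>\<^bsub>R\<^esub> s \<oplus>\<^bsub>R\<^esub> d r v, \<tau> r v))\<rparr>"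

definition rank1_incl :: "('r, 'v, 'l) rmodule_scheme \<Rightarrow> 'r \<Rightarrow> 'r \<times> 'v"
  where "rank1_incl V r = (r, \<zero>\<^bsub>V\<^esub>)"


section \<open>Universal R-rings\<close>

text \<open>The universal property, tested against all R-rings whose elements lie in the type \<open>'a\<close>.\<close>

definition is_universal_R_ring ::
  "'a itself \<Rightarrow> ('r, 'k) ring_scheme \<Rightarrow> ('r, 'm, 'l) bimod_scheme \<Rightarrow> ('r \<Rightarrow> 'm)
    \<Rightarrow> ('u, 'p) ring_scheme \<Rightarrow> ('r \<Rightarrow> 'u) \<Rightarrow> ('m \<Rightarrow> 'u) \<Rightarrow> bool"
  where "is_universal_R_ring (_ :: 'a itself) R M \<xi> U lamU j \<longleftrightarrow>
    R_ring R U lamU \<and> j \<in> bimod_hom R M (ring_bimod U lamU) \<and>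
    (\<forall>r\<in>carrier R. j (\<xi> r) = lamU r) \<and>
    (\<forall>(A :: 'a ring) lamA f.
      R_ring R A lamA \<and> f \<in> bimod_hom R M (ring_bimod A lamA) \<and>
      (\<forall>r\<in>carrier R. f (\<xi> r) = lamA r) \<longrightarrow>
      (\<exists>\<phi>\<in>R_ring_hom R U lamU A lamA. (\<forall>m\<in>carrier M. \<phi> (j m) = f m) \<and>
        (\<forall>\<psi>\<in>R_ring_hom R U lamU A lamA. (\<forall>m\<in>carrier M. \<psi> (j m) = f m) \<longrightarrow>
          (\<forall>u\<in>carrier U. \<psi> u = \<phi> u))))"

text \<open>Isabelle/HOL cannot quantify over all types inside a formula, so \<open>U(M,\<xi>)\<close> is realised as a
  specific ring: the free ring on symbols \<open>[m]\<close>, for \<open>m\<close> in \<open>M\<close>, modulo the relations which say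
  that \<open>[_]\<close> is a bimodule map along \<open>\<xi>\<close>. Theorem \<open>univ_ring_universal\<close> below shows that it has the
  universal property with respect to every type of test rings, and \<open>is_universal_R_ring_unique\<close> that
  this determines it up to R-ring isomorphism.

  The free ring is the ring of finitely supported integer-valued functions on words.\<close>

datatype 'm word = Word (letters: "'m list")

instantiation word :: (type) monoid_add
begin

definition zero_word :: "'a word" where "0 = Word []"

definition plus_word :: "'a word \<Rightarrow> 'a word \<Rightarrow> 'a word"
  where "v + w = Word (letters v @ letters w)"

instance
  by standard (simp_all add: zero_word_def plus_word_def)

end

definition free_ring :: "'m set \<Rightarrow> ('m word \<Rightarrow>\<^sub>0 int) ring"
  where "free_ring X =
    \<lparr>carrier = {p. \<forall>w\<in>Poly_Mapping.keys p. set (letters w) \<subseteq> X}, monoid.mult = (*), one = 1,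
     zero = 0, add = (+)\<rparr>"

definition free_gen :: "'m \<Rightarrow> 'm word \<Rightarrow>\<^sub>0 int"
  where "free_gen m = frag_of (Word [m])"

definition univ_relations ::
  "('r, 'k) ring_scheme \<Rightarrow> ('r, 'm, 'l) bimod_scheme \<Rightarrow> ('r \<Rightarrow> 'm) \<Rightarrow> ('m word \<Rightarrow>\<^sub>0 int) set"
  where "univ_relations R M \<xi> =
    {free_gen (m \<oplus>\<^bsub>M\<^esub> m') - (free_gen m + free_gen m') | m m'. m \<in> carrier M \<and> m' \<in> carrier M} \<union>
    {free_gen (lsmult M r m) - free_gen (\<xi> r) * free_gen m | r m. r \<in> carrier R \<and> m \<in> carrier M} \<union>
    {free_gen (rsmult M m r) - free_gen m * free_gen (\<xi> r) | m r. r \<in> carrier R \<and> m \<in> carrier M} \<union>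
    {free_gen (\<xi> \<one>\<^bsub>R\<^esub>) - 1}"

definition univ_ideal ::
  "('r, 'k) ring_scheme \<Rightarrow> ('r, 'm, 'l) bimod_scheme \<Rightarrow> ('r \<Rightarrow> 'm) \<Rightarrow> ('m word \<Rightarrow>\<^sub>0 int) set"
  where "univ_ideal R M \<xi> = genideal (free_ring (carrier M)) (univ_relations R M \<xi>)"

definition univ_ring ::
  "('r, 'k) ring_scheme \<Rightarrow> ('r, 'm, 'l) bimod_scheme \<Rightarrow> ('r \<Rightarrow> 'm) \<Rightarrow> ('m word \<Rightarrow>\<^sub>0 int) set ring"
  where "univ_ring R M \<xi> = free_ring (carrier M) Quot univ_ideal R M \<xi>"

definition univ_map ::
  "('r, 'k) ring_scheme \<Rightarrow> ('r, 'm, 'l) bimod_scheme \<Rightarrow> ('r \<Rightarrow> 'm) \<Rightarrow> 'm \<Rightarrow> ('m word \<Rightarrow>\<^sub>0 int) set"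
  where "univ_map R M \<xi> m = univ_ideal R M \<xi> +>\<^bsub>free_ring (carrier M)\<^esub> free_gen m"

definition univ_lam ::
  "('r, 'k) ring_scheme \<Rightarrow> ('r, 'm, 'l) bimod_scheme \<Rightarrow> ('r \<Rightarrow> 'm) \<Rightarrow> 'r \<Rightarrow> ('m word \<Rightarrow>\<^sub>0 int) set"
  where "univ_lam R M \<xi> r = univ_map R M \<xi> (\<xi> r)"


subsection \<open>Existence and uniqueness\<close>

lemma free_ring_simps:
  "carrier (free_ring X) = {p. \<forall>w\<in>Poly_Mapping.keys p. set (letters w) \<subseteq> X}"
  "mult (free_ring X) = (*)" "one (free_ring X) = 1" "zero (free_ring X) = 0"
  "add (free_ring X) = (+)"
  by (simp_all add: free_ring_def)

lemma free_ring_closed: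
  "0 \<in> carrier (free_ring X)" "1 \<in> carrier (free_ring X)"
  "p \<in> carrier (free_ring X) \<Longrightarrow> q \<in> carrier (free_ring X) \<Longrightarrow> p + q \<in> carrier (free_ring X)"
  "p \<in> carrier (free_ring X) \<Longrightarrow> q \<in> carrier (free_ring X) \<Longrightarrow> p * q \<in> carrier (free_ring X)"
  "p \<in> carrier (free_ring X) \<Longrightarrow> - p \<in> carrier (free_ring X)"
  "p \<in> carrier (free_ring X) \<Longrightarrow> q \<in> carrier (free_ring X) \<Longrightarrow> p - q \<in> carrier (free_ring X)"
  "m \<in> X \<Longrightarrow> free_gen m \<in> carrier (free_ring X)"
proof -
  show "0 \<in> carrier (free_ring X)" "1 \<in> carrier (free_ring X)"
    by (auto simp: free_ring_simps zero_word_def simp flip: single_one)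
  assume p: "p \<in> carrier (free_ring X)"
  show "- p \<in> carrier (free_ring X)"
    using p by (auto simp: free_ring_simps in_keys_iff)
  assume q: "q \<in> carrier (free_ring X)"
  show "p + q \<in> carrier (free_ring X)"
    using p q keys_add[of p q] by (auto simp: free_ring_simps)
  show "p - q \<in> carrier (free_ring X)"
    using p q keys_diff[of p q] by (auto simp: free_ring_simps)
  show "p * q \<in> carrier (free_ring X)"
    using p q keys_mult[of p q] by (fastforce simp: free_ring_simps plus_word_def)
next
  assume "m \<in> X"
  then show "free_gen m \<in> carrier (free_ring X)"
    by (simp add: free_ring_simps free_gen_def)
qed

lemma ring_free_ring: "ring (free_ring X)"
proof (rule ringI)
  show "abelian_group (free_ring X)"
  proof (rule abelian_groupI)
    fix p assume "p \<in> carrier (free_ring X)"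
    then show "\<exists>q\<in>carrier (free_ring X). q \<oplus>\<^bsub>free_ring X\<^esub> p = \<zero>\<^bsub>free_ring X\<^esub>"
      by (intro bexI[of _ "- p"]) (simp_all add: free_ring_closed free_ring_simps(4,5))
  qed (simp_all add: free_ring_closed free_ring_simps(4,5) add_ac)
  show "monoid (free_ring X)"
    by (rule monoidI) (simp_all add: free_ring_closed free_ring_simps(2,3) mult.assoc)
qed (simp_all add: free_ring_simps(2,5) algebra_simps)

lemma free_ring_minus:
  assumes "p \<in> carrier (free_ring X)" "q \<in> carrier (free_ring X)"
  shows "p \<ominus>\<^bsub>free_ring X\<^esub> q = p - q"
proof -
  interpret F: ring "free_ring X" by (rule ring_free_ring)
  have "\<ominus>\<^bsub>free_ring X\<^esub> q = - q"
    using assms by (intro F.minus_equality) (simp_all add: free_ring_closed free_ring_simps(4,5))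
  then show ?thesis
    by (simp add: a_minus_def free_ring_simps(5))
qed

lemma free_ring_induct [consumes 1, case_names one gen mult diff]:
  assumes p: "p \<in> carrier (free_ring X)"
    and one: "P 1"
    and gen: "\<And>m. m \<in> X \<Longrightarrow> P (free_gen m)"
    and mult: "\<And>p q. \<lbrakk>p \<in> carrier (free_ring X); q \<in> carrier (free_ring X); P p; P q\<rbrakk> \<Longrightarrow> P (p * q)"
    and diff: "\<And>p q. \<lbrakk>p \<in> carrier (free_ring X); q \<in> carrier (free_ring X); P p; P q\<rbrakk> \<Longrightarrow> P (p - q)"
  shows "P p"
proof -
  let ?Q = "\<lambda>p. p \<in> carrier (free_ring X) \<and> P p"
  have word: "?Q (frag_of (Word ms))" if "set ms \<subseteq> X" for ms
    using that
  proof (induction ms)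
    case Nil
    have "frag_of (Word []) = (1 :: 'a word \<Rightarrow>\<^sub>0 int)"
      by (simp add: zero_word_def flip: single_one)
    then show ?case
      using one by (simp add: free_ring_closed)
  next
    case (Cons m ms)
    have "frag_of (Word (m # ms)) = free_gen m * frag_of (Word ms)"
      by (simp add: free_gen_def mult_single plus_word_def)
    with Cons show ?case
      by (auto intro!: mult gen free_ring_closed)
  qed
  have "Poly_Mapping.keys p \<subseteq> {w. set (letters w) \<subseteq> X}"
    using p by (auto simp: free_ring_simps)
  then have "?Q p"
  proof (induction p rule: frag_induction)
    case zero
    show ?case
      using diff[of 1 1] one by (simp add: free_ring_closed)
  next
    case (one w)
    then show ?case
      using word[of "letters w"] by simp
  next
    case (diff a b)
    then show ?case
      using assms(5)[of a b] by (simp add: free_ring_closed)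
  qed
  then show ?thesis ..
qed

text \<open>The homomorphism out of the free ring given by the images of the generators.\<close>

lemma free_ring_lift:
  fixes A :: "('a, 'l) ring_scheme"
  assumes "ring A" and f: "f \<in> X \<rightarrow> carrier A"
  obtains h where "h \<in> ring_hom (free_ring X) A" "\<And>m. m \<in> X \<Longrightarrow> h (free_gen m) = f m"
proof -
  interpret A: ring A by fact
  define g where "g m = (if m \<in> X then f m else \<zero>\<^bsub>A\<^esub>)" for m
  have g: "g m \<in> carrier A" for m
    using f by (auto simp: g_def)
  define W where "W w = word_prod A (map g (letters w))" for w
  have W [simp]: "W w \<in> carrier A" for w
  proof -
    have "word_prod A (map g ms) \<in> carrier A" for ms
      by (induction ms) (simp_all add: word_prod_def g)
    then show ?thesis by (simp add: W_def)
  qed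
  have W_add: "W (v + w) = W v \<otimes>\<^bsub>A\<^esub> W w" for v w
  proof -
    have closed: "word_prod A (map g ms) \<in> carrier A" for ms
      using W[of "Word ms"] by (simp add: W_def)
    have "word_prod A (map g (ms @ ns)) = word_prod A (map g ms) \<otimes>\<^bsub>A\<^esub> word_prod A (map g ns)" for ms ns
    proof (induction ms)
      case Nil
      then show ?case using closed[of ns] by (simp add: word_prod_def)
    next
      case (Cons m ms)
      then show ?case
        using closed[of ms] closed[of ns] g[of m] by (simp add: word_prod_def A.m_assoc)
    qed
    then show ?thesis by (simp add: W_def plus_word_def)
  qed
  define h where
    "h p = (\<Oplus>\<^bsub>A\<^esub>w\<in>Poly_Mapping.keys p. [Poly_Mapping.lookup p w] \<cdot>\<^bsub>A\<^esub> W w)" for p :: "'b word \<Rightarrow>\<^sub>0 int"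
  have zero_pow: "[(0 :: int)] \<cdot>\<^bsub>A\<^esub> a = \<zero>\<^bsub>A\<^esub>" for a
    by (simp add: add_pow_def)
  have h_super: "h p = (\<Oplus>\<^bsub>A\<^esub>w\<in>F. [Poly_Mapping.lookup p w] \<cdot>\<^bsub>A\<^esub> W w)"
    if "finite F" "Poly_Mapping.keys p \<subseteq> F" for p F
    unfolding h_def using that
    by (intro A.add.finprod_mono_neutral_cong_left) (auto simp: in_keys_iff zero_pow)
  have h_closed: "h p \<in> carrier A" for p
    unfolding h_def by (intro A.finsum_closed) auto
  have h_add: "h (p + q) = h p \<oplus>\<^bsub>A\<^esub> h q" for p q
  proof -
    let ?F = "Poly_Mapping.keys p \<union> Poly_Mapping.keys q"
    have "h (p + q) = (\<Oplus>\<^bsub>A\<^esub>w\<in>?F. [Poly_Mapping.lookup (p + q) w] \<cdot>\<^bsub>A\<^esub> W w)"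
      by (intro h_super keys_add) auto
    also have "\<dots> = (\<Oplus>\<^bsub>A\<^esub>w\<in>?F. [Poly_Mapping.lookup p w] \<cdot>\<^bsub>A\<^esub> W w \<oplus>\<^bsub>A\<^esub> [Poly_Mapping.lookup q w] \<cdot>\<^bsub>A\<^esub> W w)"
      by (intro A.finsum_cong') (auto simp: lookup_add A.add.int_pow_mult)
    also have "\<dots> = h p \<oplus>\<^bsub>A\<^esub> h q"
      by (subst A.finsum_addf) (auto simp: h_super[of ?F p] h_super[of ?F q])
    finally show ?thesis .
  qed
  have h_single: "h (frag_of w) = W w" for w
  proof -
    have "h (frag_of w) = (\<Oplus>\<^bsub>A\<^esub>v\<in>{w}. [Poly_Mapping.lookup (frag_of w) v] \<cdot>\<^bsub>A\<^esub> W v)"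
      by (intro h_super) auto
    also have "\<dots> = W w"
      by (subst A.finsum_insert) (auto simp: A.add.int_pow_1)
    finally show ?thesis .
  qed
  have h_zero: "h 0 = \<zero>\<^bsub>A\<^esub>"
    by (simp add: h_def)
  have h_diff: "h (p - q) = h p \<ominus>\<^bsub>A\<^esub> h q" for p q
  proof -
    have "h (p - q) \<oplus>\<^bsub>A\<^esub> h q = h p"
      using h_add[of "p - q" q] by simp
    then show ?thesis
      using h_closed[of p] h_closed[of q] h_closed[of "p - q"]
      by (metis A.a_assoc A.a_inv_closed A.minus_eq A.r_neg A.r_zero)
  qed
  have h_mult: "h (p * q) = h p \<otimes>\<^bsub>A\<^esub> h q" for p q
  proof -
    have *: "h (frag_of v * q) = W v \<otimes>\<^bsub>A\<^esub> h q" for v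
      using subset_UNIV
    proof (induction q rule: frag_induction)
      case (diff a b)
      then show ?case
        using h_closed[of a] h_closed[of b]
        by (simp add: right_diff_distrib h_diff A.minus_eq A.r_distr A.r_minus)
    qed (simp_all add: h_zero h_single mult_single W_add)
    show ?thesis
      using subset_UNIV
    proof (induction p rule: frag_induction)
      case (diff a b)
      then show ?case
        using h_closed[of a] h_closed[of b] h_closed[of q]
        by (simp add: left_diff_distrib h_diff A.minus_eq A.l_distr A.l_minus)
    qed (simp_all add: h_zero h_single h_closed *)
  qed
  have "h 1 = \<one>\<^bsub>A\<^esub>"
  proof -
    have "h 1 = W 0"
      by (simp add: h_single flip: single_one)
    then show ?thesis by (simp add: W_def zero_word_def word_prod_def)
  qed
  then have "h \<in> ring_hom (free_ring X) A"
    by (intro ring_hom_memI) (auto simp: h_closed h_mult h_add free_ring_simps(2,3,5))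
  moreover have "h (free_gen m) = f m" if "m \<in> X" for m
    using that g[of m] by (simp add: free_gen_def h_single W_def word_prod_def g_def)
  ultimately show thesis by (rule that)
qed

lemma ring_bimod_simps:
  "carrier (ring_bimod A lam) = carrier A" "zero (ring_bimod A lam) = zero A"
  "add (ring_bimod A lam) = add A"
  "rsmult (ring_bimod A lam) a r = a \<otimes>\<^bsub>A\<^esub> lam r" "lsmult (ring_bimod A lam) r a = lam r \<otimes>\<^bsub>A\<^esub> a"
  by (simp_all add: ring_bimod_def)

theorem univ_ring_universal:
  assumes M: "bimodule R M" and xi: "\<xi> \<in> bimod_hom R (ring_bimod R (\<lambda>r. r)) M"
  shows "is_universal_R_ring TYPE('a) R M \<xi> (univ_ring R M \<xi>) (univ_lam R M \<xi>) (univ_map R M \<xi>)"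
proof -
  interpret M: bimodule R M by (rule M)
  let ?F = "free_ring (carrier M)" and ?I = "univ_ideal R M \<xi>"
  let ?U = "univ_ring R M \<xi>" and ?lam = "univ_lam R M \<xi>" and ?j = "univ_map R M \<xi>"
  interpret F: ring ?F by (rule ring_free_ring)
  have xi_closed [simp]: "\<xi> r \<in> carrier M" if "r \<in> carrier R" for r
    using xi that by (auto simp: bimod_hom_def rmod_hom_def ring_bimod_simps)
  have xi_add: "\<xi> (r \<oplus>\<^bsub>R\<^esub> s) = \<xi> r \<oplus>\<^bsub>M\<^esub> \<xi> s" if "r \<in> carrier R" "s \<in> carrier R" for r s
    using xi that by (auto simp: bimod_hom_def rmod_hom_def ring_bimod_simps)
  have xi_mult: "\<xi> (r \<otimes>\<^bsub>R\<^esub> s) = lsmult M r (\<xi> s)" if "r \<in> carrier R" "s \<in> carrier R" for r s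
    using xi that by (auto simp: bimod_hom_def rmod_hom_def ring_bimod_simps)
  have rel: "univ_relations R M \<xi> \<subseteq> carrier ?F"
    unfolding univ_relations_def
    by (auto intro!: free_ring_closed M.lsmult_closed M.rsmult_closed xi_closed)
  interpret I: ideal ?I ?F
    unfolding univ_ideal_def by (rule F.genideal_ideal[OF rel])
  let ?c = "\<lambda>p. ?I +>\<^bsub>?F\<^esub> p"
  have c_hom: "?c \<in> ring_hom ?F ?U"
    unfolding univ_ring_def by (rule I.rcos_ring_hom)
  interpret U: ring ?U
    unfolding univ_ring_def by (rule I.quotient_is_ring)
  interpret c: ring_hom_ring ?F ?U ?c
    by (intro ring_hom_ringI2 F.ring_axioms U.ring_axioms c_hom)
  have U_carrier: "\<exists>p\<in>carrier ?F. u = ?c p" if "u \<in> carrier ?U" for u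
    using that unfolding univ_ring_def FactRing_def A_RCOSETS_def' by auto
  have c_eq: "?c p = ?c q" if "p - q \<in> univ_relations R M \<xi>" "p \<in> carrier ?F" "q \<in> carrier ?F" for p q
  proof -
    have "p - q \<in> ?I"
      unfolding univ_ideal_def using that(1) F.genideal_self[OF rel] by blast
    then show ?thesis
      using F.quotient_eq_iff_same_a_r_cos[OF I.ideal_axioms that(2,3)] that(2,3)
      by (simp add: free_ring_minus)
  qed
  have j_closed [simp]: "?j m \<in> carrier ?U" if "m \<in> carrier M" for m
    unfolding univ_map_def using that by (intro c.hom_closed free_ring_closed)
  have j_add: "?j (m \<oplus>\<^bsub>M\<^esub> m') = ?j m \<oplus>\<^bsub>?U\<^esub> ?j m'" if "m \<in> carrier M" "m' \<in> carrier M" for m m'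
  proof -
    have "?c (free_gen (m \<oplus>\<^bsub>M\<^esub> m')) = ?c (free_gen m + free_gen m')"
      using that by (intro c_eq) (auto simp: univ_relations_def intro!: free_ring_closed)
    also have "\<dots> = ?c (free_gen m) \<oplus>\<^bsub>?U\<^esub> ?c (free_gen m')"
      using that c.hom_add[of "free_gen m" "free_gen m'"] by (simp add: free_ring_closed free_ring_simps(5))
    finally show ?thesis by (simp add: univ_map_def)
  qed
  have j_l: "?j (lsmult M r m) = ?lam r \<otimes>\<^bsub>?U\<^esub> ?j m" if "r \<in> carrier R" "m \<in> carrier M" for r m
  proof -
    have "?c (free_gen (lsmult M r m)) = ?c (free_gen (\<xi> r) * free_gen m)"
      using that by (intro c_eq) (auto simp: univ_relations_def intro!: free_ring_closed M.lsmult_closed)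
    also have "\<dots> = ?c (free_gen (\<xi> r)) \<otimes>\<^bsub>?U\<^esub> ?c (free_gen m)"
      using that c.hom_mult[of "free_gen (\<xi> r)" "free_gen m"] by (simp add: free_ring_closed free_ring_simps(2))
    finally show ?thesis by (simp add: univ_map_def univ_lam_def)
  qed
  have j_r: "?j (rsmult M m r) = ?j m \<otimes>\<^bsub>?U\<^esub> ?lam r" if "r \<in> carrier R" "m \<in> carrier M" for r m
  proof -
    have "?c (free_gen (rsmult M m r)) = ?c (free_gen m * free_gen (\<xi> r))"
      using that by (intro c_eq) (auto simp: univ_relations_def intro!: free_ring_closed M.rsmult_closed)
    also have "\<dots> = ?c (free_gen m) \<otimes>\<^bsub>?U\<^esub> ?c (free_gen (\<xi> r))"
      using that c.hom_mult[of "free_gen m" "free_gen (\<xi> r)"] by (simp add: free_ring_closed free_ring_simps(2))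
    finally show ?thesis by (simp add: univ_map_def univ_lam_def)
  qed
  have j_one: "?j (\<xi> \<one>\<^bsub>R\<^esub>) = \<one>\<^bsub>?U\<^esub>"
  proof -
    have "?c (free_gen (\<xi> \<one>\<^bsub>R\<^esub>)) = ?c 1"
      by (intro c_eq) (auto simp: univ_relations_def intro!: free_ring_closed)
    also have "\<dots> = \<one>\<^bsub>?U\<^esub>"
      using c.hom_one by (simp add: free_ring_simps(3))
    finally show ?thesis by (simp add: univ_map_def)
  qed
  have RU: "R_ring R ?U ?lam"
  proof
    show "?lam \<in> ring_hom R ?U"
    proof (rule ring_hom_memI)
      fix r s assume rs: "r \<in> carrier R" "s \<in> carrier R"
      then show "?lam (r \<otimes>\<^bsub>R\<^esub> s) = ?lam r \<otimes>\<^bsub>?U\<^esub> ?lam s"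
        using j_l[of r "\<xi> s"] by (simp add: univ_lam_def xi_mult)
      show "?lam (r \<oplus>\<^bsub>R\<^esub> s) = ?lam r \<oplus>\<^bsub>?U\<^esub> ?lam s"
        using rs by (simp add: univ_lam_def xi_add j_add)
    qed (simp_all add: univ_lam_def j_one)
  qed
  have j: "?j \<in> bimod_hom R M (ring_bimod ?U ?lam)"
    by (auto simp: bimod_hom_def rmod_hom_def ring_bimod_simps j_add j_l j_r)
  have univ: "\<exists>\<phi>\<in>R_ring_hom R ?U ?lam A lamA. (\<forall>m\<in>carrier M. \<phi> (?j m) = f m) \<and>
        (\<forall>\<psi>\<in>R_ring_hom R ?U ?lam A lamA. (\<forall>m\<in>carrier M. \<psi> (?j m) = f m) \<longrightarrow>
          (\<forall>u\<in>carrier ?U. \<psi> u = \<phi> u))"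
    if A: "R_ring R A lamA" and f: "f \<in> bimod_hom R M (ring_bimod A lamA)"
      and fxi: "\<forall>r\<in>carrier R. f (\<xi> r) = lamA r"
    for A :: "'a ring" and lamA f
  proof -
    interpret A: R_ring R A lamA by (rule A)
    have f_closed: "f m \<in> carrier A" if "m \<in> carrier M" for m
      using f that by (auto simp: bimod_hom_def rmod_hom_def ring_bimod_simps)
    obtain h where h: "h \<in> ring_hom ?F A" and h_gen: "\<And>m. m \<in> carrier M \<Longrightarrow> h (free_gen m) = f m"
      using free_ring_lift[OF A.A.ring_axioms, of f "carrier M"] f_closed by blast
    interpret h: ring_hom_ring ?F A h
      by (intro ring_hom_ringI2 F.ring_axioms A.A.ring_axioms h)
    have h_diff: "h (p - q) = h p \<ominus>\<^bsub>A\<^esub> h q" if "p \<in> carrier ?F" "q \<in> carrier ?F" for p q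
      using that free_ring_minus[of p _ q] by (metis F.a_inv_closed a_minus_def h.hom_a_inv h.hom_add)
    have h_mult: "h (p * q) = h p \<otimes>\<^bsub>A\<^esub> h q" and h_add: "h (p + q) = h p \<oplus>\<^bsub>A\<^esub> h q"
      if "p \<in> carrier ?F" "q \<in> carrier ?F" for p q
      using that h.hom_mult[of p q] h.hom_add[of p q] by (simp_all add: free_ring_simps(2,5))
    have ker_iff: "q \<in> a_kernel ?F A h \<longleftrightarrow> q \<in> carrier ?F \<and> h q = \<zero>\<^bsub>A\<^esub>" for q
      unfolding a_kernel_def' by blast
    have ker: "ideal (a_kernel ?F A h) ?F"
      by (rule h.kernel_is_ideal)
    have "univ_relations R M \<xi> \<subseteq> a_kernel ?F A h"
    proof
      fix p assume p: "p \<in> univ_relations R M \<xi>"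
      have lamA1: "lamA \<one>\<^bsub>R\<^esub> = \<one>\<^bsub>A\<^esub>"
        using A.lam_hom by (auto simp: ring_hom_def)
      have h1: "h 1 = \<one>\<^bsub>A\<^esub>"
        using h.hom_one by (simp add: free_ring_simps(3))
      have lamA_closed: "lamA r \<in> carrier A" if "r \<in> carrier R" for r
        using A.lam_hom that by (auto simp: ring_hom_def)
      have "h p = \<zero>\<^bsub>A\<^esub>"
        using p f f_closed fxi lamA1 h1 unfolding univ_relations_def bimod_hom_def rmod_hom_def
        by (auto simp: h_diff h_mult h_add h_gen free_ring_closed M.lsmult_closed M.rsmult_closed
            ring_bimod_simps A.A.minus_eq A.A.r_neg lamA_closed)
      then show "p \<in> a_kernel ?F A h"
        using p rel ker_iff by blast
    qed
    then have I_ker: "?I \<subseteq> a_kernel ?F A h"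
      unfolding univ_ideal_def by (rule F.genideal_minimal[OF ker])
    define \<phi> where "\<phi> u = the_elem (h ` u)" for u
    have \<phi>: "\<phi> (?c p) = h p" if p: "p \<in> carrier ?F" for p
    proof -
      have "h ` ?c p = {h p}"
      proof -
        have "h q = h p" if "q \<in> ?c p" for q
        proof -
          obtain i where i: "i \<in> ?I" "q = i \<oplus>\<^bsub>?F\<^esub> p"
            using \<open>q \<in> ?c p\<close> unfolding a_r_coset_def' by blast
          have "i \<in> carrier ?F" "h i = \<zero>\<^bsub>A\<^esub>"
            using i(1) I_ker ker_iff by blast+
          then show ?thesis
            using i(2) p by simp
        qed
        moreover have "p \<in> ?c p"
          using I.a_rcos_self[OF p] .
        ultimately show ?thesis by blast
      qed
      then show ?thesis by (simp add: \<phi>_def)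
    qed
    have \<phi>_hom: "\<phi> \<in> ring_hom ?U A"
    proof (rule ring_hom_memI)
      fix u v assume u: "u \<in> carrier ?U" and v: "v \<in> carrier ?U"
      from U_carrier[OF u] obtain p where p: "p \<in> carrier ?F" "u = ?c p" ..
      from U_carrier[OF v] obtain q where q: "q \<in> carrier ?F" "v = ?c q" ..
      note pq = p(1) q(1) p(2) q(2)
      show "\<phi> (u \<otimes>\<^bsub>?U\<^esub> v) = \<phi> u \<otimes>\<^bsub>A\<^esub> \<phi> v"
      proof -
        have "\<phi> (u \<otimes>\<^bsub>?U\<^esub> v) = \<phi> (?c (p \<otimes>\<^bsub>?F\<^esub> q))"
          unfolding pq(3,4) c.hom_mult[OF pq(1,2)] ..
        also have "\<dots> = h p \<otimes>\<^bsub>A\<^esub> h q"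
          using pq(1,2) by (subst \<phi>) auto
        also have "\<dots> = \<phi> u \<otimes>\<^bsub>A\<^esub> \<phi> v"
          unfolding pq(3,4) \<phi>[OF pq(1)] \<phi>[OF pq(2)] ..
        finally show ?thesis .
      qed
      show "\<phi> (u \<oplus>\<^bsub>?U\<^esub> v) = \<phi> u \<oplus>\<^bsub>A\<^esub> \<phi> v"
      proof -
        have "\<phi> (u \<oplus>\<^bsub>?U\<^esub> v) = \<phi> (?c (p \<oplus>\<^bsub>?F\<^esub> q))"
          unfolding pq(3,4) c.hom_add[OF pq(1,2)] ..
        also have "\<dots> = h p \<oplus>\<^bsub>A\<^esub> h q"
          using pq(1,2) by (subst \<phi>) auto
        also have "\<dots> = \<phi> u \<oplus>\<^bsub>A\<^esub> \<phi> v"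
          unfolding pq(3,4) \<phi>[OF pq(1)] \<phi>[OF pq(2)] ..
        finally show ?thesis .
      qed
    next
      fix u assume u: "u \<in> carrier ?U"
      from U_carrier[OF u] obtain p where p: "p \<in> carrier ?F" "u = ?c p" ..
      show "\<phi> u \<in> carrier A"
        unfolding p(2) \<phi>[OF p(1)] using p(1) by (rule h.hom_closed)
    next
      show "\<phi> \<one>\<^bsub>?U\<^esub> = \<one>\<^bsub>A\<^esub>"
        using \<phi>[OF F.one_closed] unfolding c.hom_one h.hom_one .
    qed
    have \<phi>_j: "\<phi> (?j m) = f m" if "m \<in> carrier M" for m
      using that by (simp add: univ_map_def \<phi> free_ring_closed h_gen)
    have "\<phi> \<in> R_ring_hom R ?U ?lam A lamA"
      using \<phi>_hom fxi by (simp add: R_ring_hom_def univ_lam_def \<phi>_j)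
    moreover have "\<psi> u = \<phi> u"
      if psi: "\<psi> \<in> R_ring_hom R ?U ?lam A lamA" "\<forall>m\<in>carrier M. \<psi> (?j m) = f m" and u: "u \<in> carrier ?U"
      for \<psi> u
    proof -
      have "\<psi> \<in> ring_hom ?U A"
        using psi by (simp add: R_ring_hom_def)
      then interpret psi: ring_hom_ring ?U A \<psi>
        by (intro ring_hom_ringI2 U.ring_axioms A.A.ring_axioms)
      interpret phi: ring_hom_ring ?U A \<phi>
        by (intro ring_hom_ringI2 U.ring_axioms A.A.ring_axioms \<phi>_hom)
      obtain p where p: "p \<in> carrier ?F" "u = ?c p"
        using U_carrier[OF u] ..
      from p(1) have "\<psi> (?c p) = \<phi> (?c p)"
      proof (induction p rule: free_ring_induct)
        case one
        show ?case
          using c.hom_one psi.hom_one phi.hom_one by (simp add: free_ring_simps(3))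
      next
        case (gen m)
        then show ?case
          using psi(2) \<phi>_j by (simp add: univ_map_def)
      next
        case (mult p q)
        then show ?case
          using c.hom_mult[of p q] by (simp add: free_ring_simps(2))
      next
        case (diff p q)
        have "?c (p - q) = ?c p \<ominus>\<^bsub>?U\<^esub> ?c q"
          using diff by (simp add: a_minus_def flip: free_ring_minus[of p "carrier M" q])
        with diff show ?case
          by (simp add: a_minus_def)
      qed
      with p(2) show ?thesis by simp
    qed
    ultimately show ?thesis
      using \<phi>_j by blast
  qed
  show ?thesis
    unfolding is_universal_R_ring_def
  proof (intro conjI allI impI)
    show "\<forall>r\<in>carrier R. ?j (\<xi> r) = ?lam r"
      by (simp add: univ_lam_def)
  qed (use RU j univ in blast)+
qed

theorem is_universal_R_ring_unique:
  fixes U :: "'u ring" and W :: "'w ring"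
  assumes U: "is_universal_R_ring TYPE('u) R M \<xi> U lamU j" "is_universal_R_ring TYPE('w) R M \<xi> U lamU j"
    and W: "is_universal_R_ring TYPE('w) R M \<xi> W lamW k" "is_universal_R_ring TYPE('u) R M \<xi> W lamW k"
    and xi: "\<xi> \<in> carrier R \<rightarrow> carrier M"
  shows "R_ring_isomorphic R U lamU W lamW"
proof -
  have jk: "R_ring R U lamU" "j \<in> bimod_hom R M (ring_bimod U lamU)" "\<forall>r\<in>carrier R. j (\<xi> r) = lamU r"
    "R_ring R W lamW" "k \<in> bimod_hom R M (ring_bimod W lamW)" "\<forall>r\<in>carrier R. k (\<xi> r) = lamW r"
    using U(1) W(1) by (simp_all add: is_universal_R_ring_def)
  obtain f where f: "f \<in> R_ring_hom R U lamU W lamW" "\<forall>m\<in>carrier M. f (j m) = k m"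
    using U(2) jk unfolding is_universal_R_ring_def by blast
  obtain g where g: "g \<in> R_ring_hom R W lamW U lamU" "\<forall>m\<in>carrier M. g (k m) = j m"
    using W(2) jk unfolding is_universal_R_ring_def by blast
  have gf: "g (f u) = u" if "u \<in> carrier U" for u
  proof -
    have "g \<circ> f \<in> R_ring_hom R U lamU U lamU" "\<forall>m\<in>carrier M. (g \<circ> f) (j m) = j m"
      using f g by (auto simp: R_ring_hom_def intro: ring_hom_trans)
    moreover have "(\<lambda>x. x) \<in> R_ring_hom R U lamU U lamU"
      by (auto simp: R_ring_hom_def ring_hom_def)
    moreover obtain \<phi> where "\<And>\<psi> u. \<lbrakk>\<psi> \<in> R_ring_hom R U lamU U lamU;
        \<forall>m\<in>carrier M. \<psi> (j m) = j m; u \<in> carrier U\<rbrakk> \<Longrightarrow> \<psi> u = \<phi> u"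
      using U(1) jk unfolding is_universal_R_ring_def by metis
    ultimately show ?thesis
      using that by (metis comp_apply)
  qed
  have fg: "f (g w) = w" if "w \<in> carrier W" for w
  proof -
    have "f \<circ> g \<in> R_ring_hom R W lamW W lamW" "\<forall>m\<in>carrier M. (f \<circ> g) (k m) = k m"
      using f g by (auto simp: R_ring_hom_def intro: ring_hom_trans)
    moreover have "(\<lambda>x. x) \<in> R_ring_hom R W lamW W lamW"
      by (auto simp: R_ring_hom_def ring_hom_def)
    moreover obtain \<phi> where "\<And>\<psi> w. \<lbrakk>\<psi> \<in> R_ring_hom R W lamW W lamW;
        \<forall>m\<in>carrier M. \<psi> (k m) = k m; w \<in> carrier W\<rbrakk> \<Longrightarrow> \<psi> w = \<phi> w"
      using W(1) jk unfolding is_universal_R_ring_def by metis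
    ultimately show ?thesis
      using that by (metis comp_apply)
  qed
  have "bij_betw f (carrier U) (carrier W)"
    using f(1) g(1) gf fg
    by (intro bij_betw_byWitness[where f' = g]) (auto simp: R_ring_hom_def ring_hom_def)
  with f(1) show ?thesis
    unfolding R_ring_isomorphic_def by blast
qed

text \<open>The universal R-ring is taken along an actual bimodule map.\<close>

lemma rank1_ext_bimodule:
  assumes V: "right_module R V" and tau: "\<tau> \<in> ring_hom R (End_ring R V)"
    and d: "tau_derivation R V \<tau> d"
  shows "bimodule R (rank1_ext R V \<tau> d)"
    and "rank1_incl V \<in> bimod_hom R (ring_bimod R (\<lambda>r. r)) (rank1_ext R V \<tau> d)"
proof -
  interpret V: right_module R V by (rule V)
  let ?M = "rank1_ext R V \<tau> d"
  have M: "carrier ?M = carrier R \<times> carrier V" "zero ?M = (\<zero>\<^bsub>R\<^esub>, \<zero>\<^bsub>V\<^esub>)"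
    "(s, v) \<oplus>\<^bsub>?M\<^esub> (s', v') = (s \<oplus>\<^bsub>R\<^esub> s', v \<oplus>\<^bsub>V\<^esub> v')"
    "rsmult ?M (s, v) r = (s \<otimes>\<^bsub>R\<^esub> r, rsmult V v r)"
    "lsmult ?M r (s, v) = (r \<otimes>\<^bsub>R\<^esub> s \<oplus>\<^bsub>R\<^esub> d r v, \<tau> r v)" for s v s' v' r
    by (simp_all add: rank1_ext_def)
  have t_mem: "\<tau> r \<in> rmod_hom R V V" if "r \<in> carrier R" for r
    using tau that by (auto simp: ring_hom_def End_ring_def)
  have t: "\<tau> r v \<in> carrier V" "\<tau> r (v \<oplus>\<^bsub>V\<^esub> w) = \<tau> r v \<oplus>\<^bsub>V\<^esub> \<tau> r w"
    "\<tau> r (rsmult V v s) = rsmult V (\<tau> r v) s"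
    if "r \<in> carrier R" "s \<in> carrier R" "v \<in> carrier V" "w \<in> carrier V" for r s v w
    using t_mem[of r] that by (auto simp: rmod_hom_def)
  have t_hom: "\<tau> (r \<oplus>\<^bsub>R\<^esub> s) v = \<tau> r v \<oplus>\<^bsub>V\<^esub> \<tau> s v" "\<tau> (r \<otimes>\<^bsub>R\<^esub> s) v = \<tau> r (\<tau> s v)" "\<tau> \<one>\<^bsub>R\<^esub> v = v"
    if "r \<in> carrier R" "s \<in> carrier R" "v \<in> carrier V" for r s v
    using tau that by (auto simp: ring_hom_def End_ring_def compose_def)
  have d_mem: "d r \<in> rmod_hom R V (ring_bimod R (\<lambda>r. r))" if "r \<in> carrier R" for r
    using d that by (auto simp: tau_derivation_def)
  have d_lin: "d r v \<in> carrier R" "d r (v \<oplus>\<^bsub>V\<^esub> w) = d r v \<oplus>\<^bsub>R\<^esub> d r w"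
    "d r (rsmult V v s) = d r v \<otimes>\<^bsub>R\<^esub> s"
    if "r \<in> carrier R" "s \<in> carrier R" "v \<in> carrier V" "w \<in> carrier V" for r s v w
    using d_mem[of r] that by (auto simp: rmod_hom_def ring_bimod_simps)
  have d_der: "d (r \<oplus>\<^bsub>R\<^esub> s) v = d r v \<oplus>\<^bsub>R\<^esub> d s v"
    "d (r \<otimes>\<^bsub>R\<^esub> s) v = d r (\<tau> s v) \<oplus>\<^bsub>R\<^esub> r \<otimes>\<^bsub>R\<^esub> d s v"
    if "r \<in> carrier R" "s \<in> carrier R" "v \<in> carrier V" for r s v
    using d that by (auto simp: tau_derivation_def)
  have t_c: "\<tau> r v \<in> carrier V" and d_c: "d r v \<in> carrier R"
    if "r \<in> carrier R" "v \<in> carrier V" for r v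
    using t(1) d_lin(1) that by blast+
  have d_one: "d \<one>\<^bsub>R\<^esub> v = \<zero>\<^bsub>R\<^esub>" if "v \<in> carrier V" for v
    using d_der(2)[of "\<one>\<^bsub>R\<^esub>" "\<one>\<^bsub>R\<^esub>" v] that d_c[of "\<one>\<^bsub>R\<^esub>" v] t_hom(3)[of "\<one>\<^bsub>R\<^esub>" "\<one>\<^bsub>R\<^esub>" v]
      V.R.add.l_cancel_one'[of "d \<one>\<^bsub>R\<^esub> v" "d \<one>\<^bsub>R\<^esub> v"] by simp
  have d_zero: "d r \<zero>\<^bsub>V\<^esub> = \<zero>\<^bsub>R\<^esub>" and t_zero: "\<tau> r \<zero>\<^bsub>V\<^esub> = \<zero>\<^bsub>V\<^esub>" if "r \<in> carrier R" for r
    using d_lin(2)[of r r "\<zero>\<^bsub>V\<^esub>" "\<zero>\<^bsub>V\<^esub>"] t(2)[of r r "\<zero>\<^bsub>V\<^esub>" "\<zero>\<^bsub>V\<^esub>"] d_c[of r "\<zero>\<^bsub>V\<^esub>"] t_c[of r "\<zero>\<^bsub>V\<^esub>"] that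
      V.R.add.l_cancel_one'[of "d r \<zero>\<^bsub>V\<^esub>" "d r \<zero>\<^bsub>V\<^esub>"] V.V.add.l_cancel_one'[of "\<tau> r \<zero>\<^bsub>V\<^esub>" "\<tau> r \<zero>\<^bsub>V\<^esub>"]
    by simp_all
  have rs_zero: "rsmult V \<zero>\<^bsub>V\<^esub> r = \<zero>\<^bsub>V\<^esub>" if "r \<in> carrier R" for r
    using V.rsmult_add[of "\<zero>\<^bsub>V\<^esub>" "\<zero>\<^bsub>V\<^esub>" r] V.rsmult_closed[of "\<zero>\<^bsub>V\<^esub>" r] that
      V.V.add.l_cancel_one'[of "rsmult V \<zero>\<^bsub>V\<^esub> r" "rsmult V \<zero>\<^bsub>V\<^esub> r"] by simp
  interpret Mab: abelian_group ?M
  proof (rule abelian_groupI)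
    fix m assume "m \<in> carrier ?M"
    then obtain s v where m: "m = (s, v)" "s \<in> carrier R" "v \<in> carrier V"
      by (auto simp: M)
    then show "\<exists>m'\<in>carrier ?M. m' \<oplus>\<^bsub>?M\<^esub> m = \<zero>\<^bsub>?M\<^esub>"
      by (intro bexI[of _ "(\<ominus>\<^bsub>R\<^esub> s, \<ominus>\<^bsub>V\<^esub> v)"]) (simp_all add: M V.R.l_neg V.V.l_neg)
  qed (auto simp: M V.R.a_ac V.V.a_ac)
  show "bimodule R ?M"
    by unfold_locales
      (auto simp: M V.rsmult_closed V.rsmult_add V.rsmult_radd V.rsmult_assoc V.rsmult_one
        t t_hom d_lin d_der d_one t_c d_c
        V.R.l_distr V.R.r_distr V.R.m_assoc V.R.a_ac)
  show "rank1_incl V \<in> bimod_hom R (ring_bimod R (\<lambda>r. r)) ?M"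
    by (auto simp: bimod_hom_def rmod_hom_def ring_bimod_simps rank1_incl_def M rs_zero d_zero t_zero)
qed

corollary univ_ring_rank1_ext_universal:
  assumes "right_module R V" "\<tau> \<in> ring_hom R (End_ring R V)" "tau_derivation R V \<tau> d"
  shows "is_universal_R_ring TYPE('a) R (rank1_ext R V \<tau> d) (rank1_incl V)
    (univ_ring R (rank1_ext R V \<tau> d) (rank1_incl V))
    (univ_lam R (rank1_ext R V \<tau> d) (rank1_incl V))
    (univ_map R (rank1_ext R V \<tau> d) (rank1_incl V))"
  by (intro univ_ring_universal rank1_ext_bimodule assms)

end

theory Submission
  imports Defs "HOL-Algebra.Subrings"
begin

text \<open>Let \<open>V\<close> be the module of columns of length \<open>n\<close>, on which \<open>\<sigma>(r)\<close> acts as a matrix and \<open>\<delta>(r)\<close> as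
  a row. The map \<open>(s, v) \<mapsto> s + \<Sum>\<^sub>i x\<^sub>i v\<^sub>i\<close> from \<open>M = R \<oplus> V\<close> to the free skew extension \<open>S\<close> is a bimodule
  map by the commutation rule, so it lifts to an R-ring homomorphism \<open>h: U(M, \<iota>) \<rightarrow> S\<close>. Conversely
  \<open>S\<close> is free on the words in the \<open>x\<^sub>i\<close>, so there is a right \<open>R\<close>-linear \<open>g: S \<rightarrow> U(M, \<iota>)\<close> replacing
  each \<open>x\<^sub>i\<close> by \<open>y\<^sub>i = j(0, e\<^sub>i)\<close>, and \<open>h \<circ> g = id\<close>. The image of \<open>g\<close> contains 1 and is stable under left
  multiplication by \<open>j(M)\<close>, because an element of \<open>R\<close> moves past \<open>y\<^sub>i\<close> at the cost of another element of
  \<open>j(M)\<close>; as \<open>j(M)\<close> generates \<open>U(M, \<iota>)\<close>, \<open>g\<close> is onto and \<open>h\<close> is bijective.\<close>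

section \<open>Finite sums and bases of right modules\<close>

text \<open>Serves for properties closed under addition, such as membership in a span or in an
  additive image: a finite sum inherits them from its terms.\<close>

lemma (in abelian_group) finsum_induct:
  assumes "finite F" "f \<in> F \<rightarrow> carrier G" "P \<zero>"
    and "\<And>a b. \<lbrakk>a \<in> carrier G; b \<in> carrier G; P a; P b\<rbrakk> \<Longrightarrow> P (a \<oplus> b)"
    and "\<And>i. i \<in> F \<Longrightarrow> P (f i)"
  shows "P (\<Oplus>i\<in>F. f i)"
  using assms(1,2,5)
proof (induction F rule: finite_induct)
  case empty
  then show ?case using assms(3) by simp
next
  case (insert i F)
  then have "f i \<in> carrier G" "(\<Oplus>i\<in>F. f i) \<in> carrier G"
    by (auto intro!: finsum_closed)
  with insert show ?case
    using assms(4)[of "f i" "\<Oplus>i\<in>F. f i"] by (auto simp: Pi_def)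
qed

lemma finsum_hom:
  assumes V: "abelian_group V" and W: "abelian_group W"
    and h: "h \<in> carrier V \<rightarrow> carrier W"
    and add: "\<And>v w. \<lbrakk>v \<in> carrier V; w \<in> carrier V\<rbrakk> \<Longrightarrow> h (v \<oplus>\<^bsub>V\<^esub> w) = h v \<oplus>\<^bsub>W\<^esub> h w"
    and F: "finite F" "f \<in> F \<rightarrow> carrier V"
  shows "h (\<Oplus>\<^bsub>V\<^esub>i\<in>F. f i) = (\<Oplus>\<^bsub>W\<^esub>i\<in>F. h (f i))"
proof -
  interpret V: abelian_group V by (rule V)
  interpret W: abelian_group W by (rule W)
  have hc: "h v \<in> carrier W" if "v \<in> carrier V" for v
    using h that by blast
  \<comment> \<open>Additivity gives h 0 = h 0 + h 0, and cancellation in the group \<open>W\<close>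
    leaves zero.\<close>
  have "h \<zero>\<^bsub>V\<^esub> = \<zero>\<^bsub>W\<^esub>"
    using add[of "\<zero>\<^bsub>V\<^esub>" "\<zero>\<^bsub>V\<^esub>"] hc[of "\<zero>\<^bsub>V\<^esub>"] W.add.l_cancel_one'[of "h \<zero>\<^bsub>V\<^esub>" "h \<zero>\<^bsub>V\<^esub>"] by simp
  with F show ?thesis
  proof (induction F rule: finite_induct)
    case (insert i F)
    then have "f i \<in> carrier V" "f \<in> F \<rightarrow> carrier V" "(\<lambda>i. h (f i)) \<in> F \<rightarrow> carrier W"
      by (auto intro: hc)
    then show ?case
      using insert by (simp add: add hc V.finsum_closed)
  qed simp
qed

lemma (in abelian_group) finsum_swap:
  assumes "finite I" "finite J" "\<And>i j. \<lbrakk>i \<in> I; j \<in> J\<rbrakk> \<Longrightarrow> f i j \<in> carrier G"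
  shows "(\<Oplus>i\<in>I. \<Oplus>j\<in>J. f i j) = (\<Oplus>j\<in>J. \<Oplus>i\<in>I. f i j)"
  using assms(1,3)
proof (induction I rule: finite_induct)
  case (insert a I)
  have "(\<Oplus>j\<in>J. \<Oplus>i\<in>insert a I. f i j) = (\<Oplus>j\<in>J. f a j \<oplus> (\<Oplus>i\<in>I. f i j))"
    using insert by (intro finsum_cong') (auto intro!: finsum_closed simp: Pi_def)
  also have "\<dots> = (\<Oplus>j\<in>J. f a j) \<oplus> (\<Oplus>j\<in>J. \<Oplus>i\<in>I. f i j)"
    using insert by (intro finsum_addf) (auto intro!: finsum_closed)
  also have "\<dots> = (\<Oplus>i\<in>insert a I. \<Oplus>j\<in>J. f i j)"
    using insert by (subst finsum_insert) (auto intro!: finsum_closed)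
  finally show ?case ..
qed simp

context right_module
begin

lemma rsmult_rzero: "v \<in> carrier V \<Longrightarrow> rsmult V v \<zero> = \<zero>\<^bsub>V\<^esub>"
  using rsmult_radd[of v "\<zero>" "\<zero>"] rsmult_closed[of v "\<zero>"]
    V.add.l_cancel_one'[of "rsmult V v \<zero>" "rsmult V v \<zero>"] by simp

lemma finsum_rsmult:
  assumes "finite F" "f \<in> F \<rightarrow> carrier V" "r \<in> carrier R"
  shows "rsmult V (\<Oplus>\<^bsub>V\<^esub>i\<in>F. f i) r = (\<Oplus>\<^bsub>V\<^esub>i\<in>F. rsmult V (f i) r)"
  using assms
  by (intro finsum_hom V.abelian_group_axioms) (auto intro: rsmult_closed rsmult_add)

end

text \<open>The vectors \<open>f b\<close> are kept apart from the indices \<open>b\<close>, so that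
  one coefficient family can be evaluated in two different modules. Summing over the support allows
  \<open>B\<close> to be infinite.\<close>

definition lin_comb ::
  "('r, 'k) ring_scheme \<Rightarrow> ('r, 'v, 'l) rmodule_scheme \<Rightarrow> 'b set \<Rightarrow> ('b \<Rightarrow> 'v) \<Rightarrow> ('b \<Rightarrow> 'r) \<Rightarrow> 'v"
  where "lin_comb R V B f c = (\<Oplus>\<^bsub>V\<^esub>b\<in>{b\<in>B. c b \<noteq> \<zero>\<^bsub>R\<^esub>}. rsmult V (f b) (c b))"

context right_module
begin

context
  fixes B :: "'b set" and f :: "'b \<Rightarrow> 'v"
  assumes f: "f \<in> B \<rightarrow> carrier V"
begin

text \<open>Terms outside the support vanish, so families with different supports can be compared
  over one common finite set.\<close>

lemma lin_comb_superset:
  assumes "c \<in> B \<rightarrow> carrier R" "finite F" "F \<subseteq> B" "\<And>b. b \<in> B - F \<Longrightarrow> c b = \<zero>"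
  shows "lin_comb R V B f c = (\<Oplus>\<^bsub>V\<^esub>b\<in>F. rsmult V (f b) (c b))"
  unfolding lin_comb_def using assms f
  by (intro V.add.finprod_mono_neutral_cong_left) (auto simp: rsmult_rzero Pi_def intro!: rsmult_closed)

lemma lin_comb_closed:
  assumes "c \<in> B \<rightarrow> carrier R"
  shows "lin_comb R V B f c \<in> carrier V"
  unfolding lin_comb_def using assms f by (intro V.finsum_closed) (auto intro: rsmult_closed)

lemma lin_comb_add:
  assumes c: "c \<in> B \<rightarrow> carrier R" "finite {b\<in>B. c b \<noteq> \<zero>}"
    and c': "c' \<in> B \<rightarrow> carrier R" "finite {b\<in>B. c' b \<noteq> \<zero>}"
  shows "lin_comb R V B f (\<lambda>b\<in>B. c b \<oplus> c' b) = lin_comb R V B f c \<oplus>\<^bsub>V\<^esub> lin_comb R V B f c'"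
proof -
  \<comment> \<open>Coefficients can cancel, so the support of the sum may be smaller than this
    union.\<close>
  let ?F = "{b\<in>B. c b \<noteq> \<zero>} \<union> {b\<in>B. c' b \<noteq> \<zero>}"
  have "lin_comb R V B f (\<lambda>b\<in>B. c b \<oplus> c' b) = (\<Oplus>\<^bsub>V\<^esub>b\<in>?F. rsmult V (f b) ((\<lambda>b\<in>B. c b \<oplus> c' b) b))"
    using c c' by (intro lin_comb_superset) auto
  also have "\<dots> = (\<Oplus>\<^bsub>V\<^esub>b\<in>?F. rsmult V (f b) (c b) \<oplus>\<^bsub>V\<^esub> rsmult V (f b) (c' b))"
    using c c' f by (intro V.finsum_cong') (auto simp: Pi_def rsmult_radd intro!: rsmult_closed)
  also have "\<dots> = (\<Oplus>\<^bsub>V\<^esub>b\<in>?F. rsmult V (f b) (c b)) \<oplus>\<^bsub>V\<^esub> (\<Oplus>\<^bsub>V\<^esub>b\<in>?F. rsmult V (f b) (c' b))"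
    using c c' f by (intro V.finsum_addf) (auto simp: Pi_def intro!: rsmult_closed)
  also have "\<dots> = lin_comb R V B f c \<oplus>\<^bsub>V\<^esub> lin_comb R V B f c'"
    using c c' by (subst (1 2) lin_comb_superset[of _ ?F]) auto
  finally show ?thesis .
qed

lemma lin_comb_rsmult:
  assumes c: "c \<in> B \<rightarrow> carrier R" "finite {b\<in>B. c b \<noteq> \<zero>}" and r: "r \<in> carrier R"
  shows "lin_comb R V B f (\<lambda>b\<in>B. c b \<otimes> r) = rsmult V (lin_comb R V B f c) r"
proof -
  let ?F = "{b\<in>B. c b \<noteq> \<zero>}"
  \<comment> \<open>Some products \<open>c b \<otimes> r\<close> may vanish, hence the sum over the
    support of \<open>c\<close> and not over that of the product.\<close>
  have "lin_comb R V B f (\<lambda>b\<in>B. c b \<otimes> r) = (\<Oplus>\<^bsub>V\<^esub>b\<in>?F. rsmult V (f b) ((\<lambda>b\<in>B. c b \<otimes> r) b))"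
    using c r by (intro lin_comb_superset) auto
  also have "\<dots> = (\<Oplus>\<^bsub>V\<^esub>b\<in>?F. rsmult V (rsmult V (f b) (c b)) r)"
    using c r f by (intro V.finsum_cong') (auto simp: Pi_def rsmult_assoc intro!: rsmult_closed)
  also have "\<dots> = rsmult V (lin_comb R V B f c) r"
    unfolding lin_comb_def using c r f by (intro finsum_rsmult[symmetric]) (auto intro: rsmult_closed)
  finally show ?thesis .
qed

lemma lin_comb_single:
  assumes "b \<in> B"
  shows "lin_comb R V B f (\<lambda>b'\<in>B. if b' = b then \<one> else \<zero>) = f b"
proof -
  \<comment> \<open>The index set is \<open>{b}\<close> and not the support, which is empty when
    \<open>\<one> = \<zero>\<close>.\<close>
  have "lin_comb R V B f (\<lambda>b'\<in>B. if b' = b then \<one> else \<zero>)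
      = (\<Oplus>\<^bsub>V\<^esub>b'\<in>{b}. rsmult V (f b') ((\<lambda>b'\<in>B. if b' = b then \<one> else \<zero>) b'))"
    using assms by (intro lin_comb_superset) auto
  also have "\<dots> = f b"
    using assms f by (simp add: Pi_def rsmult_one)
  finally show ?thesis .
qed

end

lemma right_basis_iff:
  "right_basis R V B \<longleftrightarrow> B \<subseteq> carrier V \<and>
    (\<forall>v\<in>carrier V. \<exists>!c. c \<in> B \<rightarrow>\<^sub>E carrier R \<and> finite {b\<in>B. c b \<noteq> \<zero>} \<and>
      v = lin_comb R V B (\<lambda>b. b) c)"
  unfolding right_basis_def lin_comb_def ..

text \<open>Every element is a finite sum of multiples of basis elements, so an additive property is
  settled on these multiples.\<close>

lemma right_basis_induct [consumes 2, case_names zero add basis]: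
  assumes B: "right_basis R V B" and v: "v \<in> carrier V"
    and zero: "P \<zero>\<^bsub>V\<^esub>"
    and add: "\<And>v w. \<lbrakk>v \<in> carrier V; w \<in> carrier V; P v; P w\<rbrakk> \<Longrightarrow> P (v \<oplus>\<^bsub>V\<^esub> w)"
    and basis: "\<And>b r. \<lbrakk>b \<in> B; r \<in> carrier R\<rbrakk> \<Longrightarrow> P (rsmult V b r)"
  shows "P v"
proof -
  obtain c where c: "c \<in> B \<rightarrow>\<^sub>E carrier R" "finite {b\<in>B. c b \<noteq> \<zero>}"
    and v: "v = (\<Oplus>\<^bsub>V\<^esub>b\<in>{b\<in>B. c b \<noteq> \<zero>}. rsmult V b (c b))"
    using B v unfolding right_basis_def by blast
  have "B \<subseteq> carrier V"
    using B by (simp add: right_basis_def)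
  with c show ?thesis
    unfolding v by (intro V.finsum_induct[where P = P] zero) (auto intro: rsmult_closed add basis)
qed

end

text \<open>The universal property of a free module: the extension reads off the coefficients of
  \<open>v\<close> in the basis \<open>B\<close> and applies them to the vectors \<open>f b\<close>.
  It is linear because taking coefficients is.\<close>

lemma right_basis_extend:
  assumes V: "right_module R V" and W: "right_module R W"
    and B: "right_basis R V B" and f: "f \<in> B \<rightarrow> carrier W"
  obtains g where "g \<in> rmod_hom R V W" "\<And>b. b \<in> B \<Longrightarrow> g b = f b"
proof -
  interpret V: right_module R V by (rule V)
  interpret W: right_module R W by (rule W)
  have BV: "(\<lambda>b. b) \<in> B \<rightarrow> carrier V"
    using B by (auto simp: right_basis_def)
  define coeffs where "coeffs = {c \<in> B \<rightarrow>\<^sub>E carrier R. finite {b\<in>B. c b \<noteq> \<zero>\<^bsub>R\<^esub>}}"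
  have ex: "\<exists>!c. c \<in> coeffs \<and> v = lin_comb R V B (\<lambda>b. b) c" if "v \<in> carrier V" for v
    using B that by (simp add: V.right_basis_iff coeffs_def conj_assoc)
  define C where "C v = (THE c. c \<in> coeffs \<and> v = lin_comb R V B (\<lambda>b. b) c)" for v
  have C: "C v \<in> coeffs" "lin_comb R V B (\<lambda>b. b) (C v) = v" if "v \<in> carrier V" for v
    using theI'[OF ex[OF that]] by (simp_all add: C_def)
  have C_eq: "C v = c"
    if "v \<in> carrier V" "c \<in> coeffs" "lin_comb R V B (\<lambda>b. b) c = v" for v c
    using the1_equality[OF ex[OF that(1)], of c] that(2,3) by (simp add: C_def)
  have coeffsD: "c \<in> B \<rightarrow> carrier R" "finite {b\<in>B. c b \<noteq> \<zero>\<^bsub>R\<^esub>}" if "c \<in> coeffs" for c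
    using that by (auto simp: coeffs_def)
  have coeffs_add: "(\<lambda>b\<in>B. c b \<oplus>\<^bsub>R\<^esub> c' b) \<in> coeffs" if "c \<in> coeffs" "c' \<in> coeffs" for c c'
  proof -
    have "{b\<in>B. (\<lambda>b\<in>B. c b \<oplus>\<^bsub>R\<^esub> c' b) b \<noteq> \<zero>\<^bsub>R\<^esub>} \<subseteq> {b\<in>B. c b \<noteq> \<zero>\<^bsub>R\<^esub>} \<union> {b\<in>B. c' b \<noteq> \<zero>\<^bsub>R\<^esub>}"
      by auto
    from that finite_subset[OF this] show ?thesis
      unfolding coeffs_def by auto
  qed
  have coeffs_mult: "(\<lambda>b\<in>B. c b \<otimes>\<^bsub>R\<^esub> r) \<in> coeffs" if "c \<in> coeffs" "r \<in> carrier R" for c r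
  proof -
    have "{b\<in>B. (\<lambda>b\<in>B. c b \<otimes>\<^bsub>R\<^esub> r) b \<noteq> \<zero>\<^bsub>R\<^esub>} \<subseteq> {b\<in>B. c b \<noteq> \<zero>\<^bsub>R\<^esub>}"
      using that by auto
    from that finite_subset[OF this] show ?thesis
      unfolding coeffs_def by auto
  qed
  have coeffs_single: "(\<lambda>b'\<in>B. if b' = b then \<one>\<^bsub>R\<^esub> else \<zero>\<^bsub>R\<^esub>) \<in> coeffs" for b
  proof -
    have "{b'\<in>B. (\<lambda>b'\<in>B. if b' = b then \<one>\<^bsub>R\<^esub> else \<zero>\<^bsub>R\<^esub>) b' \<noteq> \<zero>\<^bsub>R\<^esub>} \<subseteq> {b}"
      by auto
    from finite_subset[OF this] show ?thesis
      unfolding coeffs_def by auto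
  qed
  \<comment> \<open>By uniqueness of coefficients: the pointwise sum is a finitely supported family
    that represents the sum of \<open>v\<close> and \<open>w\<close>. The next two facts follow in
    the same way.\<close>
  have C_add: "C (v \<oplus>\<^bsub>V\<^esub> w) = (\<lambda>b\<in>B. C v b \<oplus>\<^bsub>R\<^esub> C w b)" if "v \<in> carrier V" "w \<in> carrier V" for v w
    using that by (intro C_eq coeffs_add C) (simp_all add: V.lin_comb_add[OF BV] coeffsD C)
  have C_mult: "C (rsmult V v r) = (\<lambda>b\<in>B. C v b \<otimes>\<^bsub>R\<^esub> r)" if "v \<in> carrier V" "r \<in> carrier R" for v r
    using that by (intro C_eq coeffs_mult C)
      (simp_all add: V.lin_comb_rsmult[OF BV] coeffsD C V.rsmult_closed)
  have C_basis: "C b = (\<lambda>b'\<in>B. if b' = b then \<one>\<^bsub>R\<^esub> else \<zero>\<^bsub>R\<^esub>)" if "b \<in> B" for b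
    using that BV by (intro C_eq coeffs_single) (auto simp: V.lin_comb_single[OF BV])
  have C_closed: "C v b \<in> carrier R" if "v \<in> carrier V" "b \<in> B" for v b
    using coeffsD(1)[OF C(1)[OF that(1)]] that(2) by blast
  define g where "g v = lin_comb R W B f (C v)" for v
  have "g \<in> rmod_hom R V W"
    unfolding rmod_hom_def g_def
    by (auto simp: C_add C_mult W.lin_comb_add[OF f] W.lin_comb_rsmult[OF f] coeffsD C C_closed
        intro!: W.lin_comb_closed[OF f])
  moreover have "g b = f b" if "b \<in> B" for b
    using that by (simp add: g_def C_basis W.lin_comb_single[OF f])
  ultimately show thesis by (rule that)
qed


section \<open>Column modules\<close>

text \<open>Maps of free right modules act by matrices on columns from the left.\<close>

definition col_module :: "('r, 'k) ring_scheme \<Rightarrow> nat \<Rightarrow> ('r, nat \<Rightarrow> 'r) rmodule"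
  where "col_module R n =
    \<lparr>carrier = {..<n} \<rightarrow>\<^sub>E carrier R, monoid.mult = undefined, one = undefined,
     zero = (\<lambda>i\<in>{..<n}. \<zero>\<^bsub>R\<^esub>), add = (\<lambda>v w. \<lambda>i\<in>{..<n}. v i \<oplus>\<^bsub>R\<^esub> w i),
     rsmult = (\<lambda>v r. \<lambda>i\<in>{..<n}. v i \<otimes>\<^bsub>R\<^esub> r)\<rparr>"

text \<open>The standard basis column with index \<open>i\<close>; it is the zero column if
  \<open>i \<ge> n\<close>.\<close>

definition unit_col :: "('r, 'k) ring_scheme \<Rightarrow> nat \<Rightarrow> nat \<Rightarrow> nat \<Rightarrow> 'r"
  where "unit_col R n i = (\<lambda>k\<in>{..<n}. if k = i then \<one>\<^bsub>R\<^esub> else \<zero>\<^bsub>R\<^esub>)"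

lemma col_module_mem:
  "v \<in> carrier (col_module R n) \<longleftrightarrow> v \<in> extensional {..<n} \<and> (\<forall>i<n. v i \<in> carrier R)"
  by (auto simp: col_module_def PiE_iff)

lemma col_module_simps:
  "zero (col_module R n) = (\<lambda>i\<in>{..<n}. \<zero>\<^bsub>R\<^esub>)"
  "v \<oplus>\<^bsub>col_module R n\<^esub> w = (\<lambda>i\<in>{..<n}. v i \<oplus>\<^bsub>R\<^esub> w i)"
  "rsmult (col_module R n) v r = (\<lambda>i\<in>{..<n}. v i \<otimes>\<^bsub>R\<^esub> r)"
  by (simp_all add: col_module_def)

context ring
begin

text \<open>Associativity of row times matrix times column, by distributivity and exchange of the
  two sums. It serves the multiplicativity of \<open>tau\<close>, the product rule of
  \<open>der\<close> and the commutation rule in the skew extension.\<close>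

lemma finsum_mult_assoc:
  assumes "finite I" "finite J"
    and a: "a \<in> I \<rightarrow> carrier R" and b: "\<And>i j. \<lbrakk>i \<in> I; j \<in> J\<rbrakk> \<Longrightarrow> b i j \<in> carrier R"
    and c: "c \<in> J \<rightarrow> carrier R"
  shows "(\<Oplus>j\<in>J. (\<Oplus>i\<in>I. a i \<otimes> b i j) \<otimes> c j) = (\<Oplus>i\<in>I. a i \<otimes> (\<Oplus>j\<in>J. b i j \<otimes> c j))"
proof -
  have a': "a i \<in> carrier R" if "i \<in> I" for i using a that by blast
  have c': "c j \<in> carrier R" if "j \<in> J" for j using c that by blast
  have "(\<Oplus>j\<in>J. (\<Oplus>i\<in>I. a i \<otimes> b i j) \<otimes> c j) = (\<Oplus>j\<in>J. \<Oplus>i\<in>I. a i \<otimes> b i j \<otimes> c j)"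
    using assms(1) a' b c' by (intro finsum_cong') (auto intro!: finsum_ldistr finsum_closed)
  also have "\<dots> = (\<Oplus>i\<in>I. \<Oplus>j\<in>J. a i \<otimes> b i j \<otimes> c j)"
    using assms(1,2) a' b c' by (intro finsum_swap) auto
  also have "\<dots> = (\<Oplus>i\<in>I. a i \<otimes> (\<Oplus>j\<in>J. b i j \<otimes> c j))"
    using assms(2) a' b c'
    by (intro finsum_cong') (auto simp: finsum_rdistr m_assoc intro!: finsum_closed finsum_cong')
  finally show ?thesis .
qed

lemma col_module_right_module: "right_module R (col_module R n)"
proof -
  interpret V: abelian_group "col_module R n"
  proof (rule abelian_groupI)
    fix v assume "v \<in> carrier (col_module R n)"
    then show "\<exists>w\<in>carrier (col_module R n). w \<oplus>\<^bsub>col_module R n\<^esub> v = \<zero>\<^bsub>col_module R n\<^esub>"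
      by (intro bexI[of _ "\<lambda>i\<in>{..<n}. \<ominus> v i"])
        (auto simp: col_module_mem col_module_simps l_neg intro!: restrict_ext)
  next
    fix v assume v: "v \<in> carrier (col_module R n)"
    then have "(\<lambda>i\<in>{..<n}. v i) = v"
      by (simp add: col_module_mem extensional_restrict)
    moreover have "\<zero>\<^bsub>col_module R n\<^esub> \<oplus>\<^bsub>col_module R n\<^esub> v = (\<lambda>i\<in>{..<n}. v i)"
      using v by (auto simp: col_module_mem col_module_simps intro!: restrict_ext)
    ultimately show "\<zero>\<^bsub>col_module R n\<^esub> \<oplus>\<^bsub>col_module R n\<^esub> v = v" by simp
  qed (auto simp: col_module_mem col_module_simps a_assoc intro!: restrict_ext a_comm)
  show ?thesis
  proof unfold_locales
    fix v assume v: "v \<in> carrier (col_module R n)"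
    then have "(\<lambda>i\<in>{..<n}. v i) = v"
      by (simp add: col_module_mem extensional_restrict)
    moreover have "rsmult (col_module R n) v \<one> = (\<lambda>i\<in>{..<n}. v i)"
      using v by (auto simp: col_module_mem col_module_simps intro!: restrict_ext)
    ultimately show "rsmult (col_module R n) v \<one> = v" by simp
  qed (auto simp: col_module_mem col_module_simps l_distr r_distr m_assoc intro!: restrict_ext)
qed

lemma unit_col_closed: "unit_col R n i \<in> carrier (col_module R n)"
  by (auto simp: unit_col_def col_module_mem col_module_simps)

text \<open>Evaluation at the index \<open>k\<close> is additive, so it passes through the
  sum.\<close>

lemma finsum_col_module:
  assumes "finite F" "f \<in> F \<rightarrow> carrier (col_module R n)" "k < n"
  shows "(\<Oplus>\<^bsub>col_module R n\<^esub>i\<in>F. f i) k = (\<Oplus>i\<in>F. f i k)"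
proof -
  interpret V: right_module R "col_module R n" by (rule col_module_right_module)
  show ?thesis
    using assms
    by (intro finsum_hom[where h = "\<lambda>v. v k"] V.V.abelian_group_axioms abelian_group_axioms)
      (auto simp: col_module_mem col_module_simps)
qed

lemma finsum_unit_col:
  assumes "c \<in> {..<n} \<rightarrow> carrier R"
  shows "(\<Oplus>\<^bsub>col_module R n\<^esub>i\<in>{..<n}. rsmult (col_module R n) (unit_col R n i) (c i)) = (\<lambda>i\<in>{..<n}. c i)"
    (is "?s = _")
proof -
  interpret V: right_module R "col_module R n" by (rule col_module_right_module)
  have c: "c i \<in> carrier R" if "i < n" for i
    using assms that by auto
  have closed: "(\<lambda>i. rsmult (col_module R n) (unit_col R n i) (c i)) \<in> {..<n} \<rightarrow> carrier (col_module R n)"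
    using c by (auto intro: V.rsmult_closed unit_col_closed)
  then have "?s \<in> extensional {..<n}"
    using V.V.finsum_closed col_module_mem by blast
  moreover have "?s k = c k" if "k < n" for k
  proof -
    have "?s k = (\<Oplus>i\<in>{..<n}. if k = i then c i else \<zero>)"
      using closed that c by (subst finsum_col_module)
        (auto simp: col_module_mem col_module_simps unit_col_def intro!: finsum_cong')
    also have "\<dots> = c k"
      using that c by (intro finsum_singleton) auto
    finally show ?thesis .
  qed
  ultimately show ?thesis
    by (intro extensionalityI[of _ "{..<n}"]) auto
qed

text \<open>The unit columns are a basis. The hypothesis \<open>\<one> \<noteq> \<zero>\<close>
  keeps them distinct, so that there are exactly \<open>n\<close> of them.\<close>

lemma free_right_module_col_module:
  assumes "\<one> \<noteq> \<zero>"
  shows "free_right_module R (col_module R n) n"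
proof -
  let ?V = "col_module R n" and ?B = "unit_col R n ` {..<n}"
  interpret V: right_module R ?V by (rule col_module_right_module)
  have inj: "inj_on (unit_col R n) {..<n}"
  proof (rule inj_onI)
    fix i j assume ij: "i \<in> {..<n}" "j \<in> {..<n}" and "unit_col R n i = unit_col R n j"
    then have "unit_col R n i i = unit_col R n j i" by simp
    with ij assms show "i = j" by (auto simp: unit_col_def split: if_splits)
  qed
  \<comment> \<open>The basis is finite, so the sum over the support becomes a sum over all of it,
    which \<open>inj\<close> allows to be reindexed by \<open>{..<n}\<close>.\<close>
  have comb: "lin_comb R ?V ?B (\<lambda>b. b) c = (\<lambda>i\<in>{..<n}. c (unit_col R n i))"
    if c: "c \<in> ?B \<rightarrow> carrier R" for c
  proof -
    have "lin_comb R ?V ?B (\<lambda>b. b) c = (\<Oplus>\<^bsub>?V\<^esub>b\<in>?B. rsmult ?V b (c b))"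
      using c by (intro V.lin_comb_superset) (auto intro: unit_col_closed)
    also have "\<dots> = (\<Oplus>\<^bsub>?V\<^esub>i\<in>{..<n}. rsmult ?V (unit_col R n i) (c (unit_col R n i)))"
      using c inj by (intro V.V.finsum_reindex) (auto intro!: V.rsmult_closed unit_col_closed)
    also have "\<dots> = (\<lambda>i\<in>{..<n}. c (unit_col R n i))"
      using c by (intro finsum_unit_col) auto
    finally show ?thesis .
  qed
  have "\<exists>!c. c \<in> ?B \<rightarrow>\<^sub>E carrier R \<and> finite {b\<in>?B. c b \<noteq> \<zero>} \<and> v = lin_comb R ?V ?B (\<lambda>b. b) c"
    if v: "v \<in> carrier ?V" for v
  proof (rule ex1I)
    \<comment> \<open>The coefficient at a unit column is the entry of \<open>v\<close> at its
      index, which injectivity recovers.\<close>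
    let ?c = "\<lambda>b\<in>?B. v (inv_into {..<n} (unit_col R n) b)"
    have c: "?c \<in> ?B \<rightarrow>\<^sub>E carrier R" and c': "?c \<in> ?B \<rightarrow> carrier R"
      using v by (auto simp: col_module_mem inj)
    have "(\<lambda>i\<in>{..<n}. ?c (unit_col R n i)) = (\<lambda>i\<in>{..<n}. v i)"
      by (auto simp: inj intro!: restrict_ext)
    also have "\<dots> = v"
      using v by (simp add: col_module_mem extensional_restrict)
    finally have "lin_comb R ?V ?B (\<lambda>b. b) ?c = v"
      by (rule comb[OF c', THEN trans])
    with c show "?c \<in> ?B \<rightarrow>\<^sub>E carrier R \<and> finite {b\<in>?B. ?c b \<noteq> \<zero>} \<and> v = lin_comb R ?V ?B (\<lambda>b. b) ?c"
      by (intro conjI) (simp_all only: finite_Collect_conjI finite_imageI finite_lessThan Collect_mem_eq simp_thms)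
  next
    fix c assume "c \<in> ?B \<rightarrow>\<^sub>E carrier R \<and> finite {b\<in>?B. c b \<noteq> \<zero>} \<and> v = lin_comb R ?V ?B (\<lambda>b. b) c"
    then have c: "c \<in> ?B \<rightarrow>\<^sub>E carrier R" and v: "v = (\<lambda>i\<in>{..<n}. c (unit_col R n i))"
      using comb[of c] by auto
    show "c = (\<lambda>b\<in>?B. v (inv_into {..<n} (unit_col R n) b))"
      using c by (intro extensionalityI[of _ ?B]) (auto simp: v inj PiE_iff)
  qed
  then have "right_basis R ?V ?B"
    unfolding V.right_basis_iff using unit_col_closed by auto
  then show ?thesis
    unfolding free_right_module_def using card_image[OF inj] V.right_module_axioms by auto
qed

end

section \<open>The rank 1 extension defined by a skew derivation\<close>

locale skew_derivation = ring R
  for R :: "('r, 'k) ring_scheme" (structure) +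
  fixes n :: nat and \<sigma> :: "'r \<Rightarrow> nat \<Rightarrow> nat \<Rightarrow> 'r" and \<delta> :: "'r \<Rightarrow> nat \<Rightarrow> 'r"
  assumes sigma: "\<sigma> \<in> ring_hom R (mat_ring R n)"
    and delta: "right_sigma_derivation R n \<sigma> \<delta>"
begin

text \<open>The matrix \<sigma>(r) acting on columns from the left. The outer restriction makes the
  map extensional, as the elements of \<open>End_ring\<close> are.\<close>

definition tau :: "'r \<Rightarrow> (nat \<Rightarrow> 'r) \<Rightarrow> nat \<Rightarrow> 'r"
  where "tau r = (\<lambda>v\<in>carrier (col_module R n). \<lambda>i\<in>{..<n}. \<Oplus>j\<in>{..<n}. \<sigma> r i j \<otimes> v j)"

text \<open>The product of the row \<delta>(r) with the column \<open>v\<close>.\<close>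

definition der :: "'r \<Rightarrow> (nat \<Rightarrow> 'r) \<Rightarrow> 'r"
  where "der r v = (\<Oplus>j\<in>{..<n}. \<delta> r j \<otimes> v j)"

lemma sigma_closed: "\<lbrakk>r \<in> carrier R; i < n; j < n\<rbrakk> \<Longrightarrow> \<sigma> r i j \<in> carrier R"
  using ring_hom_closed[OF sigma, of r] by (auto simp: mat_ring_def)

lemma delta_closed: "\<lbrakk>r \<in> carrier R; j < n\<rbrakk> \<Longrightarrow> \<delta> r j \<in> carrier R"
  using delta unfolding right_sigma_derivation_def by auto

lemma tau_apply:
  "\<lbrakk>v \<in> carrier (col_module R n); i < n\<rbrakk> \<Longrightarrow> tau r v i = (\<Oplus>j\<in>{..<n}. \<sigma> r i j \<otimes> v j)"
  by (simp add: tau_def)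

lemma tau_closed:
  "\<lbrakk>r \<in> carrier R; v \<in> carrier (col_module R n)\<rbrakk> \<Longrightarrow> tau r v \<in> carrier (col_module R n)"
  by (auto simp: tau_def col_module_mem col_module_simps intro!: finsum_closed m_closed sigma_closed)

lemma der_closed: "\<lbrakk>r \<in> carrier R; v \<in> carrier (col_module R n)\<rbrakk> \<Longrightarrow> der r v \<in> carrier R"
  by (auto simp: der_def col_module_mem col_module_simps intro!: finsum_closed m_closed delta_closed)

lemma col_eqI:
  assumes "v \<in> carrier (col_module R n)" "w \<in> carrier (col_module R n)" "\<And>i. i < n \<Longrightarrow> v i = w i"
  shows "v = w"
  using assms by (intro extensionalityI[of v "{..<n}" w]) (auto simp: col_module_mem)

text \<open>Composing the actions of matrices is multiplying the matrices, so the laws of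
  \<open>\<sigma>\<close> carry over; each identity of columns is checked entry by entry.\<close>

lemma tau_ring_hom: "tau \<in> ring_hom R (End_ring R (col_module R n))"
proof -
  let ?V = "col_module R n"
  interpret V: right_module R ?V by (rule col_module_right_module)
  have s: "\<sigma> (r \<otimes> s) i j = (\<Oplus>k\<in>{..<n}. \<sigma> r i k \<otimes> \<sigma> s k j)" "\<sigma> (r \<oplus> s) i j = \<sigma> r i j \<oplus> \<sigma> s i j"
    "\<sigma> \<one> i j = (if i = j then \<one> else \<zero>)"
    if "r \<in> carrier R" "s \<in> carrier R" "i < n" "j < n" for r s i j
    using ring_hom_mult[OF sigma, of r s] ring_hom_add[OF sigma, of r s] ring_hom_one[OF sigma] that
    by (simp_all add: mat_ring_def)
  have v: "v j \<in> carrier R" if "v \<in> carrier ?V" "j < n" for v j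
    using that by (auto simp: col_module_mem col_module_simps)
  have hom: "tau r \<in> rmod_hom R ?V ?V" if r: "r \<in> carrier R" for r
    unfolding rmod_hom_def
  proof (intro CollectI conjI ballI funcsetI)
    fix v w assume vw: "v \<in> carrier ?V" "w \<in> carrier ?V"
    show "tau r (v \<oplus>\<^bsub>?V\<^esub> w) = tau r v \<oplus>\<^bsub>?V\<^esub> tau r w"
    proof (rule col_eqI)
      fix i assume i: "i < n"
      have "tau r (v \<oplus>\<^bsub>?V\<^esub> w) i = (\<Oplus>j\<in>{..<n}. \<sigma> r i j \<otimes> v j \<oplus> \<sigma> r i j \<otimes> w j)"
        unfolding tau_apply[OF V.V.a_closed[OF vw] i] using vw i r
        by (intro finsum_cong') (auto simp: col_module_simps(2) v sigma_closed r_distr)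
      also have "\<dots> = (tau r v \<oplus>\<^bsub>?V\<^esub> tau r w) i"
        using vw i r by (subst finsum_addf) (auto simp: col_module_simps(2) tau_apply v sigma_closed)
      finally show "tau r (v \<oplus>\<^bsub>?V\<^esub> w) i = (tau r v \<oplus>\<^bsub>?V\<^esub> tau r w) i" .
    qed (use vw r in \<open>auto intro!: tau_closed V.V.a_closed\<close>)
  next
    fix v s assume vs: "v \<in> carrier ?V" "s \<in> carrier R"
    show "tau r (rsmult ?V v s) = rsmult ?V (tau r v) s"
    proof (rule col_eqI)
      fix i assume i: "i < n"
      have "tau r (rsmult ?V v s) i = (\<Oplus>j\<in>{..<n}. \<sigma> r i j \<otimes> v j \<otimes> s)"
        unfolding tau_apply[OF V.rsmult_closed[OF vs] i] using vs i r
        by (intro finsum_cong') (auto simp: col_module_simps(3) v sigma_closed m_assoc)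
      also have "\<dots> = rsmult ?V (tau r v) s i"
        using vs i r by (subst finsum_ldistr[symmetric])
          (auto simp: col_module_simps(3) tau_apply v sigma_closed)
      finally show "tau r (rsmult ?V v s) i = rsmult ?V (tau r v) s i" .
    qed (use vs r in \<open>auto intro!: tau_closed V.rsmult_closed\<close>)
  qed (use r in \<open>auto intro: tau_closed\<close>)
  show ?thesis
  proof (rule ring_hom_memI)
    fix r assume "r \<in> carrier R"
    then show "tau r \<in> carrier (End_ring R ?V)"
      using hom by (simp add: End_ring_def tau_def)
  next
    fix r s assume rs: "r \<in> carrier R" "s \<in> carrier R"
    have "tau (r \<otimes> s) v = tau r (tau s v)" if w: "v \<in> carrier ?V" for v
    proof (rule col_eqI)
      fix i assume i: "i < n"
      have "tau (r \<otimes> s) v i = (\<Oplus>j\<in>{..<n}. (\<Oplus>k\<in>{..<n}. \<sigma> r i k \<otimes> \<sigma> s k j) \<otimes> v j)"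
        using rs w i by (auto simp: tau_apply s v sigma_closed intro!: finsum_cong' finsum_closed)
      also have "\<dots> = (\<Oplus>k\<in>{..<n}. \<sigma> r i k \<otimes> (\<Oplus>j\<in>{..<n}. \<sigma> s k j \<otimes> v j))"
        using rs w i by (intro finsum_mult_assoc) (auto simp: v sigma_closed)
      also have "\<dots> = tau r (tau s v) i"
        using rs w i by (auto simp: tau_apply tau_closed v sigma_closed intro!: finsum_cong' finsum_closed)
      finally show "tau (r \<otimes> s) v i = tau r (tau s v) i" .
    qed (use rs w in \<open>auto intro: tau_closed\<close>)
    then show "tau (r \<otimes> s) = tau r \<otimes>\<^bsub>End_ring R ?V\<^esub> tau s"
      by (auto simp: End_ring_def compose_def tau_def intro!: restrict_ext)
    have "tau (r \<oplus> s) v = tau r v \<oplus>\<^bsub>?V\<^esub> tau s v" if w: "v \<in> carrier ?V" for v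
    proof (rule col_eqI)
      fix i assume i: "i < n"
      have "tau (r \<oplus> s) v i = (\<Oplus>j\<in>{..<n}. \<sigma> r i j \<otimes> v j \<oplus> \<sigma> s i j \<otimes> v j)"
        unfolding tau_apply[OF w i] using rs w i
        by (intro finsum_cong') (auto simp: s v sigma_closed l_distr)
      also have "\<dots> = (tau r v \<oplus>\<^bsub>?V\<^esub> tau s v) i"
        using rs w i by (subst finsum_addf) (auto simp: col_module_simps(2) tau_apply v sigma_closed)
      finally show "tau (r \<oplus> s) v i = (tau r v \<oplus>\<^bsub>?V\<^esub> tau s v) i" .
    qed (use rs w in \<open>auto intro!: tau_closed V.V.a_closed\<close>)
    then show "tau (r \<oplus> s) = tau r \<oplus>\<^bsub>End_ring R ?V\<^esub> tau s"
      by (auto simp: End_ring_def tau_def intro!: restrict_ext)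
  next
    have "tau \<one> v = v" if w: "v \<in> carrier ?V" for v
    proof (rule col_eqI)
      fix i assume i: "i < n"
      have "tau \<one> v i = (\<Oplus>j\<in>{..<n}. if i = j then v j else \<zero>)"
        using w i by (auto simp: tau_apply s[OF one_closed one_closed] v intro!: finsum_cong')
      also have "\<dots> = v i"
        using w i by (intro finsum_singleton) (auto simp: v)
      finally show "tau \<one> v i = v i" .
    qed (use w in \<open>auto intro: tau_closed\<close>)
    then show "tau \<one> = \<one>\<^bsub>End_ring R ?V\<^esub>"
      by (auto simp: End_ring_def tau_def intro!: restrict_ext)
  qed
qed

text \<open>Multiplying the product rule of \<open>\<delta>\<close> by the entries of a column and
  summing gives the product rule of \<open>der\<close>.\<close>

lemma der_tau_derivation: "tau_derivation R (col_module R n) tau der"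
proof -
  let ?V = "col_module R n"
  interpret V: right_module R ?V by (rule col_module_right_module)
  have D: "\<delta> (r \<oplus> s) j = \<delta> r j \<oplus> \<delta> s j"
    "\<delta> (r \<otimes> s) j = (\<Oplus>i\<in>{..<n}. \<delta> r i \<otimes> \<sigma> s i j) \<oplus> r \<otimes> \<delta> s j"
    if "r \<in> carrier R" "s \<in> carrier R" "j < n" for r s j
    using delta that unfolding right_sigma_derivation_def by auto
  have v: "v j \<in> carrier R" if "v \<in> carrier ?V" "j < n" for v j
    using that by (auto simp: col_module_mem col_module_simps)
  have hom: "der r \<in> rmod_hom R ?V (ring_bimod R (\<lambda>r. r))" if r: "r \<in> carrier R" for r
    unfolding rmod_hom_def
  proof (intro CollectI conjI ballI funcsetI)
    fix v w assume vw: "v \<in> carrier ?V" "w \<in> carrier ?V"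
    have "der r (v \<oplus>\<^bsub>?V\<^esub> w) = (\<Oplus>j\<in>{..<n}. \<delta> r j \<otimes> v j \<oplus> \<delta> r j \<otimes> w j)"
      unfolding der_def using vw r
      by (intro finsum_cong') (auto simp: col_module_simps(2) v delta_closed r_distr)
    also have "\<dots> = der r v \<oplus>\<^bsub>ring_bimod R (\<lambda>r. r)\<^esub> der r w"
      using vw r by (subst finsum_addf) (auto simp: der_def ring_bimod_simps v delta_closed)
    finally show "der r (v \<oplus>\<^bsub>?V\<^esub> w) = der r v \<oplus>\<^bsub>ring_bimod R (\<lambda>r. r)\<^esub> der r w" .
  next
    fix v s assume vs: "v \<in> carrier ?V" "s \<in> carrier R"
    have "der r (rsmult ?V v s) = (\<Oplus>j\<in>{..<n}. \<delta> r j \<otimes> v j \<otimes> s)"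
      using vs r by (auto simp: der_def col_module_simps(3) v delta_closed m_assoc intro!: finsum_cong')
    also have "\<dots> = rsmult (ring_bimod R (\<lambda>r. r)) (der r v) s"
      using vs r by (subst finsum_ldistr[symmetric]) (auto simp: der_def ring_bimod_simps v delta_closed)
    finally show "der r (rsmult ?V v s) = rsmult (ring_bimod R (\<lambda>r. r)) (der r v) s" .
  qed (use r in \<open>auto simp: ring_bimod_simps intro: der_closed\<close>)
  have add: "der (r \<oplus> s) w = der r w \<oplus> der s w"
    if "r \<in> carrier R" "s \<in> carrier R" "w \<in> carrier ?V" for r s w
  proof -
    have "der (r \<oplus> s) w = (\<Oplus>j\<in>{..<n}. \<delta> r j \<otimes> w j \<oplus> \<delta> s j \<otimes> w j)"
      unfolding der_def using that by (intro finsum_cong') (auto simp: D v delta_closed l_distr)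
    also have "\<dots> = der r w \<oplus> der s w"
      using that by (subst finsum_addf) (auto simp: der_def v delta_closed)
    finally show ?thesis .
  qed
  have mult: "der (r \<otimes> s) w = der r (tau s w) \<oplus> r \<otimes> der s w"
    if "r \<in> carrier R" "s \<in> carrier R" "w \<in> carrier ?V" for r s w
  proof -
    have "der (r \<otimes> s) w =
        (\<Oplus>j\<in>{..<n}. (\<Oplus>i\<in>{..<n}. \<delta> r i \<otimes> \<sigma> s i j) \<otimes> w j \<oplus> r \<otimes> (\<delta> s j \<otimes> w j))"
      unfolding der_def using that
      by (intro finsum_cong') (auto simp: D v delta_closed sigma_closed l_distr m_assoc Pi_def)
    also have "\<dots> = (\<Oplus>j\<in>{..<n}. (\<Oplus>i\<in>{..<n}. \<delta> r i \<otimes> \<sigma> s i j) \<otimes> w j) \<oplus> (\<Oplus>j\<in>{..<n}. r \<otimes> (\<delta> s j \<otimes> w j))"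
      using that by (intro finsum_addf) (auto simp: v delta_closed sigma_closed intro!: finsum_closed m_closed)
    \<comment> \<open>Associativity of row, matrix and column turns (\<delta>(r) \<sigma>(s)) w into
      \<delta>(r) (\<sigma>(s) w).\<close>
    also have "(\<Oplus>j\<in>{..<n}. (\<Oplus>i\<in>{..<n}. \<delta> r i \<otimes> \<sigma> s i j) \<otimes> w j)
        = (\<Oplus>i\<in>{..<n}. \<delta> r i \<otimes> (\<Oplus>j\<in>{..<n}. \<sigma> s i j \<otimes> w j))"
      using that by (intro finsum_mult_assoc) (auto simp: v delta_closed sigma_closed)
    also have "\<dots> = der r (tau s w)"
      using that by (auto simp: der_def tau_apply v delta_closed sigma_closed intro!: finsum_cong' finsum_closed)
    also have "(\<Oplus>j\<in>{..<n}. r \<otimes> (\<delta> s j \<otimes> w j)) = r \<otimes> der s w"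
      using that by (subst finsum_rdistr[symmetric]) (auto simp: der_def v delta_closed)
    finally show ?thesis .
  qed
  show ?thesis
    unfolding tau_derivation_def using hom add mult by blast
qed

end

section \<open>R-rings and words\<close>

text \<open>Restriction of scalars along \<open>lam\<close>; it makes the facts on free right
  modules available for rings over \<open>R\<close>.\<close>

lemma (in R_ring) ring_bimod_right_module: "right_module R (ring_bimod A lam)"
proof -
  have lam: "lam r \<in> carrier A" if "r \<in> carrier R" for r
    using ring_hom_closed[OF lam_hom that] .
  interpret V: abelian_group "ring_bimod A lam"
    by (rule abelian_groupI)
      (auto simp: ring_bimod_simps A.a_ac intro: A.l_neg bexI[of _ "\<ominus>\<^bsub>A\<^esub> a" for a])
  show ?thesis
    by unfold_locales
      (auto simp: ring_bimod_simps lam A.l_distr A.r_distr A.m_assoc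
        ring_hom_add[OF lam_hom] ring_hom_mult[OF lam_hom] ring_hom_one[OF lam_hom])
qed

text \<open>The inverse of a bijective ring homomorphism \<open>h\<close> is a ring homomorphism,
  and it sends \<open>lamB r = h (lamA r)\<close> back to \<open>lamA r\<close>, because
  \<open>lamA r\<close> lies in the domain on which \<open>h\<close> is injective.\<close>

lemma R_ring_isomorphic_sym:
  assumes "ring A" and "\<And>r. r \<in> carrier R \<Longrightarrow> lamA r \<in> carrier A"
    and iso: "R_ring_isomorphic R A lamA B lamB"
  shows "R_ring_isomorphic R B lamB A lamA"
proof -
  obtain h where h: "h \<in> ring_hom A B" "bij_betw h (carrier A) (carrier B)"
    and lam: "\<And>r. r \<in> carrier R \<Longrightarrow> h (lamA r) = lamB r"
    using iso by (auto simp: R_ring_isomorphic_def R_ring_hom_def)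
  let ?g = "inv_into (carrier A) h"
  have "?g \<in> ring_iso B A"
    using h by (intro ring_iso_set_sym assms(1)) (simp add: ring_iso_def)
  moreover have "?g (lamB r) = lamA r" if "r \<in> carrier R" for r
    using that lam[OF that, symmetric] assms(2)[OF that] h(2) by (simp add: bij_betw_def)
  ultimately show ?thesis
    unfolding R_ring_isomorphic_def R_ring_hom_def ring_iso_def by blast
qed

lemma (in monoid) word_prod_closed: "set ws \<subseteq> carrier G \<Longrightarrow> word_prod G ws \<in> carrier G"
  by (induction ws) (auto simp: word_prod_def)

lemma word_prod_ring_hom:
  assumes A: "ring A" and h: "h \<in> ring_hom A B" and ws: "set ws \<subseteq> carrier A"
  shows "h (word_prod A ws) = word_prod B (map h ws)"
proof -
  interpret A: ring A by (rule A)
  show ?thesis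
    using ws
  proof (induction ws)
    case Nil
    then show ?case using ring_hom_one[OF h] by (simp add: word_prod_def)
  next
    case (Cons w ws)
    then show ?case
      using ring_hom_mult[OF h, of w "word_prod A ws"] A.word_prod_closed[of ws] by (simp add: word_prod_def)
  qed
qed

text \<open>The universal property is stated for test rings of the plain record type only.\<close>

lemma universal_R_ring_lift:
  fixes A :: "('a, 'l) ring_scheme"
  assumes U: "is_universal_R_ring TYPE('a) R M \<xi> U lamU j"
    and A: "R_ring R A lamA" and f: "f \<in> bimod_hom R M (ring_bimod A lamA)"
    and fxi: "\<forall>r\<in>carrier R. f (\<xi> r) = lamA r"
  obtains h where "h \<in> R_ring_hom R U lamU A lamA" "\<And>m. m \<in> carrier M \<Longrightarrow> h (j m) = f m"
proof -
  interpret A: R_ring R A lamA by (rule A)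
  \<comment> \<open>Truncation drops the extra record fields and keeps the ring operations, so
    homomorphisms into \<open>A'\<close> are homomorphisms into \<open>A\<close>.\<close>
  define A' where "A' = ring.truncate A"
  have A': "carrier A' = carrier A" "mult A' = mult A" "one A' = one A" "zero A' = zero A" "add A' = add A"
    by (simp_all add: A'_def ring.defs)
  have "ring A'"
  proof (rule ringI)
    show "abelian_group A'"
      by (rule abelian_groupI) (auto simp: A' A.A.a_ac intro: A.A.l_neg bexI[of _ "\<ominus>\<^bsub>A\<^esub> a" for a])
    show "monoid A'"
      by (rule monoidI) (auto simp: A' A.A.m_assoc)
  qed (auto simp: A' A.A.l_distr A.A.r_distr)
  moreover have "lamA \<in> ring_hom R A'"
    using A.lam_hom by (simp add: ring_hom_def A')
  ultimately have "R_ring R A' lamA"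
    by (intro R_ring.intro R_ring_axioms.intro A.R.ring_axioms)
  moreover have "f \<in> bimod_hom R M (ring_bimod A' lamA)"
    using f by (simp add: bimod_hom_def rmod_hom_def ring_bimod_simps A')
  ultimately obtain h where "h \<in> R_ring_hom R U lamU A' lamA" "\<forall>m\<in>carrier M. h (j m) = f m"
    using U fxi unfolding is_universal_R_ring_def by blast
  then show thesis
    by (intro that[of h]) (simp_all add: R_ring_hom_def ring_hom_def A')
qed

text \<open>Lifting \<open>j\<close> to the subring and including it back gives an endomorphism of \<open>U\<close> fixing \<open>j\<close>,
  hence the identity.\<close>

lemma universal_R_ring_generated:
  fixes U :: "'u ring"
  assumes U: "is_universal_R_ring TYPE('u) R M \<xi> U lamU j" and xi: "\<xi> \<in> carrier R \<rightarrow> carrier M"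
    and H: "subring H U" "j ` carrier M \<subseteq> H"
  shows "H = carrier U"
proof -
  have RU: "R_ring R U lamU" and j: "j \<in> bimod_hom R M (ring_bimod U lamU)"
    and jxi: "\<forall>r\<in>carrier R. j (\<xi> r) = lamU r"
    using U by (auto simp: is_universal_R_ring_def)
  interpret U: R_ring R U lamU by (rule RU)
  define A where "A = U\<lparr>carrier := H\<rparr>"
  have A: "ring A"
    unfolding A_def by (rule U.A.subring_is_ring[OF H(1)])
  \<comment> \<open>On \<open>R\<close> the structure map is \<open>j\<close> after
    \<open>\<xi>\<close>, so a set that contains the image of \<open>j\<close> contains the image of
    \<open>R\<close>.\<close>
  have "lamU r \<in> H" if "r \<in> carrier R" for r
    using jxi[rule_format, OF that, symmetric] xi H(2) that by auto
  then have "lamU \<in> ring_hom R A"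
    using U.lam_hom by (auto simp: ring_hom_def A_def)
  then have RA: "R_ring R A lamU"
    by (intro R_ring.intro R_ring_axioms.intro U.R.ring_axioms A)
  have "j \<in> bimod_hom R M (ring_bimod A lamU)"
    using j H(2) by (auto simp: bimod_hom_def rmod_hom_def ring_bimod_simps A_def)
  from universal_R_ring_lift[OF U RA this jxi] obtain h
    where h: "h \<in> R_ring_hom R U lamU A lamU" "\<And>m. m \<in> carrier M \<Longrightarrow> h (j m) = j m" by blast
  have HU: "H \<subseteq> carrier U"
    using subringE(1)[OF H(1)] .
  have "h \<in> R_ring_hom R U lamU U lamU"
    using h(1) HU by (auto simp: R_ring_hom_def ring_hom_def A_def)
  moreover have "(\<lambda>u. u) \<in> R_ring_hom R U lamU U lamU"
    by (auto simp: R_ring_hom_def ring_hom_def)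
  moreover obtain \<phi> where "\<And>\<psi> u. \<lbrakk>\<psi> \<in> R_ring_hom R U lamU U lamU;
      \<forall>m\<in>carrier M. \<psi> (j m) = j m; u \<in> carrier U\<rbrakk> \<Longrightarrow> \<psi> u = \<phi> u"
    using U RU j jxi unfolding is_universal_R_ring_def by metis
  ultimately have "h u = u" if "u \<in> carrier U" for u
    using h(2) that by metis
  moreover have "h u \<in> H" if "u \<in> carrier U" for u
    using h(1) that by (auto simp: R_ring_hom_def ring_hom_def A_def)
  ultimately show ?thesis
    using HU by fastforce
qed

section \<open>Comparison with the free skew extension\<close>

context skew_derivation
begin

abbreviation "M \<equiv> rank1_ext R (col_module R n) tau der"

text \<open>The content is left linearity. Moving \<open>lam r\<close> past each \<open>x j\<close>
  produces the \<sigma>-terms, which regroup to the value at \<open>tau r w\<close>, and the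
  \<delta>-terms, which add up to \<open>lam (der r w)\<close>.\<close>

lemma skew_extension_bimod_hom:
  assumes S: "R_ring R S lam" and x: "x \<in> {..<n} \<rightarrow> carrier S"
    and comm: "\<And>j r. \<lbrakk>j < n; r \<in> carrier R\<rbrakk> \<Longrightarrow>
      lam r \<otimes>\<^bsub>S\<^esub> x j = (\<Oplus>\<^bsub>S\<^esub>i\<in>{..<n}. x i \<otimes>\<^bsub>S\<^esub> lam (\<sigma> r i j)) \<oplus>\<^bsub>S\<^esub> lam (\<delta> r j)"
  shows "(\<lambda>(s, v). lam s \<oplus>\<^bsub>S\<^esub> (\<Oplus>\<^bsub>S\<^esub>i\<in>{..<n}. x i \<otimes>\<^bsub>S\<^esub> lam (v i))) \<in> bimod_hom R M (ring_bimod S lam)"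
proof -
  let ?V = "col_module R n"
  interpret S: R_ring R S lam by (rule S)
  note lam = ring_hom_closed[OF S.lam_hom] and lam_add = ring_hom_add[OF S.lam_hom]
    and lam_mult = ring_hom_mult[OF S.lam_hom]
  have xc: "x i \<in> carrier S" if "i < n" for i
    using x that by auto
  have v: "v j \<in> carrier R" if "v \<in> carrier ?V" "j < n" for v j
    using that by (auto simp: col_module_mem)
  define L where "L v = (\<Oplus>\<^bsub>S\<^esub>i\<in>{..<n}. x i \<otimes>\<^bsub>S\<^esub> lam (v i))" for v
  have L: "L v \<in> carrier S" if "v \<in> carrier ?V" for v
    unfolding L_def using that by (intro S.A.finsum_closed) (auto simp: xc v lam)
  have L_add: "L (v \<oplus>\<^bsub>?V\<^esub> w) = L v \<oplus>\<^bsub>S\<^esub> L w" if "v \<in> carrier ?V" "w \<in> carrier ?V" for v w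
  proof -
    have "L (v \<oplus>\<^bsub>?V\<^esub> w) = (\<Oplus>\<^bsub>S\<^esub>i\<in>{..<n}. x i \<otimes>\<^bsub>S\<^esub> lam (v i) \<oplus>\<^bsub>S\<^esub> x i \<otimes>\<^bsub>S\<^esub> lam (w i))"
      unfolding L_def using that
      by (intro S.A.finsum_cong') (auto simp: col_module_simps xc v lam lam_add S.A.r_distr)
    also have "\<dots> = L v \<oplus>\<^bsub>S\<^esub> L w"
      unfolding L_def using that by (intro S.A.finsum_addf) (auto simp: xc v lam)
    finally show ?thesis .
  qed
  have L_rsmult: "L (rsmult ?V v r) = L v \<otimes>\<^bsub>S\<^esub> lam r" if "v \<in> carrier ?V" "r \<in> carrier R" for v r
  proof -
    have "L (rsmult ?V v r) = (\<Oplus>\<^bsub>S\<^esub>i\<in>{..<n}. x i \<otimes>\<^bsub>S\<^esub> lam (v i) \<otimes>\<^bsub>S\<^esub> lam r)"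
      unfolding L_def using that
      by (intro S.A.finsum_cong') (auto simp: col_module_simps xc v lam lam_mult S.A.m_assoc)
    also have "\<dots> = L v \<otimes>\<^bsub>S\<^esub> lam r"
      unfolding L_def using that by (intro S.A.finsum_ldistr[symmetric]) (auto simp: xc v lam)
    finally show ?thesis .
  qed
  have L_lsmult: "lam r \<otimes>\<^bsub>S\<^esub> L w = L (tau r w) \<oplus>\<^bsub>S\<^esub> lam (der r w)"
    if r: "r \<in> carrier R" and w: "w \<in> carrier ?V" for r w
  proof -
    have lam_finsum: "lam (\<Oplus>j\<in>{..<n}. a j \<otimes> w j) = (\<Oplus>\<^bsub>S\<^esub>j\<in>{..<n}. lam (a j) \<otimes>\<^bsub>S\<^esub> lam (w j))"
      if a: "a \<in> {..<n} \<rightarrow> carrier R" for a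
    proof -
      have a': "a j \<in> carrier R" if "j < n" for j
        using a that by auto
      have "lam (\<Oplus>j\<in>{..<n}. a j \<otimes> w j) = (\<Oplus>\<^bsub>S\<^esub>j\<in>{..<n}. lam (a j \<otimes> w j))"
        using w a' by (intro finsum_hom abelian_group_axioms S.A.abelian_group_axioms)
          (auto simp: lam lam_add v)
      also have "\<dots> = (\<Oplus>\<^bsub>S\<^esub>j\<in>{..<n}. lam (a j) \<otimes>\<^bsub>S\<^esub> lam (w j))"
        using w a' by (intro S.A.finsum_cong') (auto simp: lam lam_mult v)
      finally show ?thesis .
    qed
    have "lam r \<otimes>\<^bsub>S\<^esub> L w = (\<Oplus>\<^bsub>S\<^esub>j\<in>{..<n}. lam r \<otimes>\<^bsub>S\<^esub> (x j \<otimes>\<^bsub>S\<^esub> lam (w j)))"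
      unfolding L_def using r w by (intro S.A.finsum_rdistr) (auto simp: xc v lam)
    also have "\<dots> = (\<Oplus>\<^bsub>S\<^esub>j\<in>{..<n}. (\<Oplus>\<^bsub>S\<^esub>i\<in>{..<n}. x i \<otimes>\<^bsub>S\<^esub> lam (\<sigma> r i j)) \<otimes>\<^bsub>S\<^esub> lam (w j)
        \<oplus>\<^bsub>S\<^esub> lam (\<delta> r j) \<otimes>\<^bsub>S\<^esub> lam (w j))"
    proof (rule S.A.finsum_cong')
      fix j assume "j \<in> {..<n}"
      then have j: "j < n" by simp
      have "(\<Oplus>\<^bsub>S\<^esub>i\<in>{..<n}. x i \<otimes>\<^bsub>S\<^esub> lam (\<sigma> r i j)) \<in> carrier S"
        using r j by (intro S.A.finsum_closed) (auto simp: xc lam sigma_closed)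
      then show "lam r \<otimes>\<^bsub>S\<^esub> (x j \<otimes>\<^bsub>S\<^esub> lam (w j)) =
          (\<Oplus>\<^bsub>S\<^esub>i\<in>{..<n}. x i \<otimes>\<^bsub>S\<^esub> lam (\<sigma> r i j)) \<otimes>\<^bsub>S\<^esub> lam (w j) \<oplus>\<^bsub>S\<^esub> lam (\<delta> r j) \<otimes>\<^bsub>S\<^esub> lam (w j)"
        using r w j by (simp add: S.A.m_assoc[symmetric] comm S.A.l_distr xc v lam delta_closed)
    qed (use r w in \<open>auto intro!: S.A.finsum_closed simp: xc v lam sigma_closed delta_closed\<close>)
    also have "\<dots> = (\<Oplus>\<^bsub>S\<^esub>j\<in>{..<n}. (\<Oplus>\<^bsub>S\<^esub>i\<in>{..<n}. x i \<otimes>\<^bsub>S\<^esub> lam (\<sigma> r i j)) \<otimes>\<^bsub>S\<^esub> lam (w j))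
        \<oplus>\<^bsub>S\<^esub> (\<Oplus>\<^bsub>S\<^esub>j\<in>{..<n}. lam (\<delta> r j) \<otimes>\<^bsub>S\<^esub> lam (w j))"
      using r w by (intro S.A.finsum_addf)
        (auto intro!: S.A.finsum_closed S.A.m_closed simp: xc v lam sigma_closed delta_closed)
    \<comment> \<open>Associativity for the row of the \<open>x i\<close>, the matrix of the
      \<open>lam (\<sigma> r i j)\<close> and the column of the \<open>lam (w j)\<close>.\<close>
    also have "(\<Oplus>\<^bsub>S\<^esub>j\<in>{..<n}. (\<Oplus>\<^bsub>S\<^esub>i\<in>{..<n}. x i \<otimes>\<^bsub>S\<^esub> lam (\<sigma> r i j)) \<otimes>\<^bsub>S\<^esub> lam (w j))
        = (\<Oplus>\<^bsub>S\<^esub>i\<in>{..<n}. x i \<otimes>\<^bsub>S\<^esub> (\<Oplus>\<^bsub>S\<^esub>j\<in>{..<n}. lam (\<sigma> r i j) \<otimes>\<^bsub>S\<^esub> lam (w j)))"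
      using r w by (intro S.A.finsum_mult_assoc) (auto simp: xc v lam sigma_closed)
    also have "\<dots> = L (tau r w)"
      unfolding L_def
    proof (rule S.A.finsum_cong')
      fix i assume "i \<in> {..<n}"
      then show "x i \<otimes>\<^bsub>S\<^esub> (\<Oplus>\<^bsub>S\<^esub>j\<in>{..<n}. lam (\<sigma> r i j) \<otimes>\<^bsub>S\<^esub> lam (w j)) = x i \<otimes>\<^bsub>S\<^esub> lam (tau r w i)"
        using r w lam_finsum[of "\<sigma> r i"] by (simp add: tau_apply sigma_closed)
    qed (use r w in \<open>auto simp: xc lam v tau_closed\<close>)
    also have "(\<Oplus>\<^bsub>S\<^esub>j\<in>{..<n}. lam (\<delta> r j) \<otimes>\<^bsub>S\<^esub> lam (w j)) = lam (der r w)"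
      unfolding der_def using r by (intro lam_finsum[symmetric]) (auto simp: delta_closed)
    finally show ?thesis .
  qed
  show ?thesis
    unfolding bimod_hom_def rmod_hom_def L_def[symmetric]
    by (auto simp: rank1_ext_def ring_bimod_simps L L_add L_rsmult L_lsmult lam lam_add lam_mult
        tau_closed der_closed S.A.l_distr S.A.r_distr S.A.a_ac)
qed

text \<open>Universality is assumed for two types of test rings: that of \<open>S\<close>, to map
  \<open>U\<close> to \<open>S\<close>, and that of \<open>U\<close>, to know that the image of
  \<open>j\<close> generates \<open>U\<close>.\<close>

lemma skew_extension_isomorphic_universal:
  fixes S :: "('s, 'l) ring_scheme" and U :: "'u ring"
  assumes ext: "free_skew_extension R n \<sigma> \<delta> S lamS x"
    and U: "is_universal_R_ring TYPE('u) R M (rank1_incl (col_module R n)) U lamU j"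
      "is_universal_R_ring TYPE('s) R M (rank1_incl (col_module R n)) U lamU j"
  shows "R_ring_isomorphic R S lamS U lamU"
proof -
  let ?V = "col_module R n" and ?X = "x ` {..<n}"
  define B where "B = submonoid_generated S ?X"
  have S: "R_ring R S lamS" and x: "x \<in> {..<n} \<rightarrow> carrier S" and inj: "inj_on x {..<n}"
    and words: "bij_betw (word_prod S) (lists ?X) B"
    and basis: "right_basis R (ring_bimod S lamS) B"
    and comm: "\<And>j r. \<lbrakk>j < n; r \<in> carrier R\<rbrakk> \<Longrightarrow>
      lamS r \<otimes>\<^bsub>S\<^esub> x j = (\<Oplus>\<^bsub>S\<^esub>i\<in>{..<n}. x i \<otimes>\<^bsub>S\<^esub> lamS (\<sigma> r i j)) \<oplus>\<^bsub>S\<^esub> lamS (\<delta> r j)"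
    using ext by (auto simp: free_skew_extension_def free_submonoid_on_def B_def)
  have RU: "R_ring R U lamU" and j: "j \<in> bimod_hom R M (ring_bimod U lamU)"
    and j_incl: "\<And>r. r \<in> carrier R \<Longrightarrow> j (r, \<zero>\<^bsub>?V\<^esub>) = lamU r"
    using U(1) by (auto simp: is_universal_R_ring_def rank1_incl_def)
  interpret V: right_module R ?V by (rule col_module_right_module)
  interpret S: R_ring R S lamS by (rule S)
  interpret U: R_ring R U lamU by (rule RU)
  interpret bS: right_module R "ring_bimod S lamS" by (rule S.ring_bimod_right_module)
  note lamS = ring_hom_closed[OF S.lam_hom]
  note lamU = ring_hom_closed[OF U.lam_hom] and lamU_mult = ring_hom_mult[OF U.lam_hom]
    and lamU_one = ring_hom_one[OF U.lam_hom]
  have lamS_zero: "lamS \<zero> = \<zero>\<^bsub>S\<^esub>"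
    by (rule ring_hom_zero[OF S.lam_hom ring_axioms S.A.ring_axioms])
  have M: "carrier M = carrier R \<times> carrier ?V" "(s, v) \<oplus>\<^bsub>M\<^esub> (s', v') = (s \<oplus> s', v \<oplus>\<^bsub>?V\<^esub> v')"
    "rsmult M (s, v) r = (s \<otimes> r, rsmult ?V v r)"
    "lsmult M r (s, v) = (r \<otimes> s \<oplus> der r v, tau r v)" for s v s' v' r
    by (simp_all add: rank1_ext_def)
  have j_closed: "j m \<in> carrier U" if "m \<in> carrier M" for m
    using j that by (auto simp: bimod_hom_def rmod_hom_def ring_bimod_simps)
  have j_add: "j (m \<oplus>\<^bsub>M\<^esub> m') = j m \<oplus>\<^bsub>U\<^esub> j m'" if "m \<in> carrier M" "m' \<in> carrier M" for m m'
    using j that by (auto simp: bimod_hom_def rmod_hom_def ring_bimod_simps)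
  have j_rsmult: "j (rsmult M m r) = j m \<otimes>\<^bsub>U\<^esub> lamU r" if "m \<in> carrier M" "r \<in> carrier R" for m r
    using j that by (auto simp: bimod_hom_def rmod_hom_def ring_bimod_simps)
  have j_lsmult: "j (lsmult M r m) = lamU r \<otimes>\<^bsub>U\<^esub> j m" if "m \<in> carrier M" "r \<in> carrier R" for m r
    using j that by (auto simp: bimod_hom_def ring_bimod_simps)

  \<comment> \<open>The homomorphism \<open>h\<close> from \<open>U\<close> to
    \<open>S\<close>\<close>
  define f where "f = (\<lambda>(s, v). lamS s \<oplus>\<^bsub>S\<^esub> (\<Oplus>\<^bsub>S\<^esub>i\<in>{..<n}. x i \<otimes>\<^bsub>S\<^esub> lamS (v i)))"
  have xc: "x i \<in> carrier S" if "i < n" for i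
    using x that by auto
  have f: "f \<in> bimod_hom R M (ring_bimod S lamS)"
    unfolding f_def by (rule skew_extension_bimod_hom[OF S x comm])
  have f_incl: "f (rank1_incl ?V r) = lamS r" if "r \<in> carrier R" for r
  proof -
    have "(\<Oplus>\<^bsub>S\<^esub>i\<in>{..<n}. x i \<otimes>\<^bsub>S\<^esub> lamS (\<zero>\<^bsub>?V\<^esub> i)) = \<zero>\<^bsub>S\<^esub>"
      by (rule S.A.add.finprod_one_eqI) (simp add: col_module_simps lamS_zero xc)
    with that show ?thesis
      by (simp add: f_def rank1_incl_def lamS)
  qed
  from universal_R_ring_lift[OF U(2) S f] f_incl obtain h
    where h: "h \<in> R_ring_hom R U lamU S lamS" and h_j: "\<And>m. m \<in> carrier M \<Longrightarrow> h (j m) = f m" by blast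
  have h_hom: "h \<in> ring_hom U S" and h_lam: "\<And>r. r \<in> carrier R \<Longrightarrow> h (lamU r) = lamS r"
    using h by (auto simp: R_ring_hom_def)

  \<comment> \<open>Words in the elements \<open>y i\<close> of \<open>U\<close>\<close>
  define y where "y i = j (\<zero>, unit_col R n i)" for i
  \<comment> \<open>For \<open>i \<ge> n\<close> the unit column is the zero column, so this holds
    for every natural number \<open>i\<close>.\<close>
  have e: "(\<zero>, unit_col R n i) \<in> carrier M" for i
    by (simp add: M unit_col_closed)
  have yc: "y i \<in> carrier U" for i
    unfolding y_def by (rule j_closed[OF e])
  have h_y: "h (y i) = x i" if "i < n" for i
  proof -
    have "(\<Oplus>\<^bsub>S\<^esub>k\<in>{..<n}. x k \<otimes>\<^bsub>S\<^esub> lamS (unit_col R n i k)) = (\<Oplus>\<^bsub>S\<^esub>k\<in>{..<n}. if i = k then x k else \<zero>\<^bsub>S\<^esub>)"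
      by (intro S.A.finsum_cong') (auto simp: unit_col_def xc lamS_zero ring_hom_one[OF S.lam_hom])
    also have "\<dots> = x i"
      using that by (intro S.A.finsum_singleton) (auto simp: xc)
    finally show ?thesis
      using that by (simp add: y_def h_j e f_def lamS_zero xc)
  qed
  \<comment> \<open>Translates the generator \<open>x i\<close> of \<open>S\<close> into
    \<open>y i\<close>, by injectivity of \<open>x\<close>. Outside the set of generators the value
    is arbitrary but still some \<open>y i\<close>, hence in \<open>U\<close>.\<close>
  define q where "q a = y (inv_into {..<n} x a)" for a
  have q_x: "q (x i) = y i" if "i < n" for i
    using that inj by (simp add: q_def)
  have qc: "q a \<in> carrier U" for a
    by (simp add: q_def yc)
  define W where "W ws = word_prod U (map q ws)" for ws
  have Wc: "W ws \<in> carrier U" for ws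
    unfolding W_def by (intro U.A.word_prod_closed) (auto simp: qc)
  have h_W: "h (W ws) = word_prod S ws" if "ws \<in> lists ?X" for ws
  proof -
    have "map (h \<circ> q) ws = ws"
      using that by (intro map_idI) (auto simp: q_x h_y)
    then show ?thesis
      unfolding W_def using word_prod_ring_hom[OF U.A.ring_axioms h_hom, of "map q ws"] qc by auto
  qed

  \<comment> \<open>The right linear section \<open>g\<close> of \<open>h\<close>\<close>
  have "(\<lambda>b. W (inv_into (lists ?X) (word_prod S) b)) \<in> B \<rightarrow> carrier (ring_bimod U lamU)"
    by (simp add: ring_bimod_simps Wc)
  \<comment> \<open>Each element of \<open>B\<close> is the product of exactly one word in the
    \<open>x i\<close>; \<open>g\<close> sends it to the corresponding word in the
    \<open>y i\<close> and is extended linearly.\<close>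
  from right_basis_extend[OF S.ring_bimod_right_module U.ring_bimod_right_module basis this]
  obtain g where g: "g \<in> rmod_hom R (ring_bimod S lamS) (ring_bimod U lamU)"
    and g_B: "\<And>b. b \<in> B \<Longrightarrow> g b = W (inv_into (lists ?X) (word_prod S) b)" by blast
  have g_closed: "g s \<in> carrier U" if "s \<in> carrier S" for s
    using g that by (auto simp: rmod_hom_def ring_bimod_simps)
  have g_add: "g (s \<oplus>\<^bsub>S\<^esub> t) = g s \<oplus>\<^bsub>U\<^esub> g t" if "s \<in> carrier S" "t \<in> carrier S" for s t
    using g that by (auto simp: rmod_hom_def ring_bimod_simps)
  have g_mult: "g (s \<otimes>\<^bsub>S\<^esub> lamS r) = g s \<otimes>\<^bsub>U\<^esub> lamU r" if "s \<in> carrier S" "r \<in> carrier R" for s r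
    using g that by (auto simp: rmod_hom_def ring_bimod_simps)
  have word_closed: "word_prod S ws \<in> carrier S" if "ws \<in> lists ?X" for ws
    using that xc by (intro S.A.word_prod_closed) auto
  have g_word: "g (word_prod S ws \<otimes>\<^bsub>S\<^esub> lamS r) = W ws \<otimes>\<^bsub>U\<^esub> lamU r"
    if "ws \<in> lists ?X" "r \<in> carrier R" for ws r
    using bij_betwE[OF words] that
    by (simp add: g_mult[OF word_closed] g_B bij_betw_inv_into_left[OF words] del: in_lists_conv_set)
  \<comment> \<open>The elements of \<open>S\<close> are finite sums of words times scalars, which
    gives this induction for additive properties.\<close>
  have S_induct [consumes 1, case_names zero add word]: "P s"
    if "s \<in> carrier S" and "P \<zero>\<^bsub>S\<^esub>"
      and "\<And>s t. \<lbrakk>s \<in> carrier S; t \<in> carrier S; P s; P t\<rbrakk> \<Longrightarrow> P (s \<oplus>\<^bsub>S\<^esub> t)"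
      and "\<And>ws r. \<lbrakk>ws \<in> lists ?X; r \<in> carrier R\<rbrakk> \<Longrightarrow> P (word_prod S ws \<otimes>\<^bsub>S\<^esub> lamS r)" for P s
  proof (rule bS.right_basis_induct[OF basis, of s P])
    fix b r assume "b \<in> B" "r \<in> carrier R"
    then show "P (rsmult (ring_bimod S lamS) b r)"
      using that(4) words by (auto simp: ring_bimod_simps bij_betw_def)
  qed (use that in \<open>auto simp: ring_bimod_simps\<close>)
  \<comment> \<open>Linearity is applied to zero times the scalar zero.\<close>
  have g_zero: "g \<zero>\<^bsub>S\<^esub> = \<zero>\<^bsub>U\<^esub>"
    using g_mult[of "\<zero>\<^bsub>S\<^esub>" \<zero>] g_closed[of "\<zero>\<^bsub>S\<^esub>"] lamS
      ring_hom_zero[OF U.lam_hom ring_axioms U.A.ring_axioms] by simp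
  \<comment> \<open>On a word times a scalar, \<open>g\<close> replaces each \<open>x i\<close> by
    \<open>y i\<close> and \<open>h\<close> reverts this; additivity does the rest.\<close>
  have h_g: "h (g s) = s" if "s \<in> carrier S" for s
    using that
  proof (induction s rule: S_induct)
    case zero
    then show ?case
      using ring_hom_zero[OF h_hom U.A.ring_axioms S.A.ring_axioms] by (simp add: g_zero)
  next
    case (add s t)
    then show ?case by (simp add: g_add ring_hom_add[OF h_hom] g_closed)
  next
    case (word ws r)
    then show ?case by (simp add: g_word ring_hom_mult[OF h_hom] Wc lamU h_W h_lam)
  qed

  \<comment> \<open>The image of \<open>g\<close> and left multiplication by the image of
    \<open>j\<close>\<close>
  define T where "T = g ` carrier S"
  have TU: "T \<subseteq> carrier U"
    using g_closed by (auto simp: T_def)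
  have T_zero: "\<zero>\<^bsub>U\<^esub> \<in> T"
    unfolding T_def by (rule image_eqI[of _ _ "\<zero>\<^bsub>S\<^esub>"]) (simp_all add: g_zero)
  have T_add: "s \<oplus>\<^bsub>U\<^esub> t \<in> T" if "s \<in> T" "t \<in> T" for s t
    using that by (auto simp: T_def g_add[symmetric])
  have T_word: "W ws \<otimes>\<^bsub>U\<^esub> lamU r \<in> T" if "ws \<in> lists ?X" "r \<in> carrier R" for ws r
    unfolding T_def g_word[OF that, symmetric] using word_closed[OF that(1)] lamS[OF that(2)] by blast
  \<comment> \<open>Left multiplication by \<open>u\<close> is additive and words times scalars span
    \<open>T\<close>, so it is enough to test \<open>u\<close> on them.\<close>
  have T_induct: "u \<otimes>\<^bsub>U\<^esub> t \<in> T" if u: "u \<in> carrier U" and t: "t \<in> T"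
    and step: "\<And>ws r. \<lbrakk>ws \<in> lists ?X; r \<in> carrier R\<rbrakk> \<Longrightarrow> u \<otimes>\<^bsub>U\<^esub> (W ws \<otimes>\<^bsub>U\<^esub> lamU r) \<in> T" for u t
  proof -
    obtain s where s: "s \<in> carrier S" and t_eq: "t = g s"
      using t by (auto simp: T_def)
    from s show ?thesis
      unfolding t_eq
    proof (induction s rule: S_induct)
      case zero
      then show ?case using u T_zero by (simp add: g_zero)
    next
      case (add s t)
      then show ?case using u T_add by (simp add: g_add g_closed U.A.r_distr)
    next
      case (word ws r)
      then show ?case using step by (simp add: g_word)
    qed
  qed
  \<comment> \<open>Left multiplication by \<open>y i\<close> prepends the letter \<open>x i\<close>
    to a word.\<close>
  have y_T: "y i \<otimes>\<^bsub>U\<^esub> t \<in> T" if "i < n" "t \<in> T" for i t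
  proof (rule T_induct[OF yc that(2)])
    fix ws r assume ws: "ws \<in> lists ?X" "r \<in> carrier R"
    have "y i \<otimes>\<^bsub>U\<^esub> W ws = W (x i # ws)"
      using that(1) by (simp add: W_def word_prod_def q_x)
    then show "y i \<otimes>\<^bsub>U\<^esub> (W ws \<otimes>\<^bsub>U\<^esub> lamU r) \<in> T"
      using ws that(1) T_word[of "x i # ws" r] by (simp add: U.A.m_assoc[symmetric] yc Wc lamU)
  qed
  \<comment> \<open>The expansion of \<open>v\<close> in unit columns writes every value of
    \<open>j\<close> as a scalar plus a right linear combination of the \<open>y i\<close>.\<close>
  have j_decomp: "j (s, v) = lamU s \<oplus>\<^bsub>U\<^esub> (\<Oplus>\<^bsub>U\<^esub>i\<in>{..<n}. y i \<otimes>\<^bsub>U\<^esub> lamU (v i))"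
    if s: "s \<in> carrier R" and v: "v \<in> carrier ?V" for s v
  proof -
    have vi: "v i \<in> carrier R" if "i < n" for i
      using v that by (simp add: col_module_mem)
    have "v = (\<Oplus>\<^bsub>?V\<^esub>i\<in>{..<n}. rsmult ?V (unit_col R n i) (v i))"
      using v finsum_unit_col[of v n] by (auto simp: col_module_mem extensional_restrict)
    then have "j (\<zero>, v) = j (\<zero>, \<Oplus>\<^bsub>?V\<^esub>i\<in>{..<n}. rsmult ?V (unit_col R n i) (v i))"
      by (rule arg_cong)
    also have "\<dots> = (\<Oplus>\<^bsub>U\<^esub>i\<in>{..<n}. j (\<zero>, rsmult ?V (unit_col R n i) (v i)))"
    proof (intro finsum_hom[where h = "\<lambda>v. j (\<zero>, v)"] V.V.abelian_group_axioms U.A.abelian_group_axioms)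
      show "j (\<zero>, v \<oplus>\<^bsub>?V\<^esub> w) = j (\<zero>, v) \<oplus>\<^bsub>U\<^esub> j (\<zero>, w)" if "v \<in> carrier ?V" "w \<in> carrier ?V" for v w
        using that j_add[of "(\<zero>, v)" "(\<zero>, w)"] by (simp add: M)
    qed (auto simp: M vi intro!: j_closed V.rsmult_closed unit_col_closed)
    also have "\<dots> = (\<Oplus>\<^bsub>U\<^esub>i\<in>{..<n}. y i \<otimes>\<^bsub>U\<^esub> lamU (v i))"
    proof (rule U.A.finsum_cong')
      fix i assume "i \<in> {..<n}"
      then show "j (\<zero>, rsmult ?V (unit_col R n i) (v i)) = y i \<otimes>\<^bsub>U\<^esub> lamU (v i)"
        using j_rsmult[OF e, of "v i" i] vi[of i] by (simp add: M y_def)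
    qed (auto simp: yc lamU vi)
    finally have "j (\<zero>, v) = (\<Oplus>\<^bsub>U\<^esub>i\<in>{..<n}. y i \<otimes>\<^bsub>U\<^esub> lamU (v i))" .
    moreover have "j (s, v) = j (s, \<zero>\<^bsub>?V\<^esub>) \<oplus>\<^bsub>U\<^esub> j (\<zero>, v)"
      using j_add[of "(s, \<zero>\<^bsub>?V\<^esub>)" "(\<zero>, v)"] s v by (simp add: M)
    ultimately show ?thesis
      using s by (simp add: j_incl)
  qed
  \<comment> \<open>Induction on the word, for all \<open>m\<close> and \<open>r\<close> at once:
    when a scalar meets the first letter, the two merge into one value of \<open>j\<close> in front
    of the shorter word, and this value is not known in advance.\<close>
  have j_word: "\<forall>m\<in>carrier M. \<forall>r\<in>carrier R. j m \<otimes>\<^bsub>U\<^esub> (W ws \<otimes>\<^bsub>U\<^esub> lamU r) \<in> T"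
    if "ws \<in> lists ?X" for ws
    using that
  proof (induction ws)
    \<comment> \<open>For a fixed word it is enough to treat scalars: in the expansion of
      \<open>j m\<close> each coefficient first acts on the word as a scalar, and then
      \<open>y i\<close> keeps the result in \<open>T\<close>.\<close>
    have step: "\<forall>m\<in>carrier M. \<forall>r\<in>carrier R. j m \<otimes>\<^bsub>U\<^esub> (W ws \<otimes>\<^bsub>U\<^esub> lamU r) \<in> T"
      if lam: "\<And>s r. \<lbrakk>s \<in> carrier R; r \<in> carrier R\<rbrakk> \<Longrightarrow> lamU s \<otimes>\<^bsub>U\<^esub> (W ws \<otimes>\<^bsub>U\<^esub> lamU r) \<in> T" for ws
    proof (intro ballI)
      fix m r assume m: "m \<in> carrier M" and r: "r \<in> carrier R"
      obtain s v where sv: "m = (s, v)" "s \<in> carrier R" "v \<in> carrier ?V"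
        using m by (auto simp: M)
      have vi: "v i \<in> carrier R" if "i < n" for i
        using sv(3) that by (simp add: col_module_mem)
      let ?t = "W ws \<otimes>\<^bsub>U\<^esub> lamU r"
      have t: "?t \<in> carrier U"
        using r by (simp add: Wc lamU)
      have sum: "(\<Oplus>\<^bsub>U\<^esub>i\<in>{..<n}. y i \<otimes>\<^bsub>U\<^esub> lamU (v i)) \<in> carrier U"
        by (intro U.A.finsum_closed) (auto simp: yc lamU vi)
      have "(\<Oplus>\<^bsub>U\<^esub>i\<in>{..<n}. y i \<otimes>\<^bsub>U\<^esub> lamU (v i)) \<otimes>\<^bsub>U\<^esub> ?t = (\<Oplus>\<^bsub>U\<^esub>i\<in>{..<n}. y i \<otimes>\<^bsub>U\<^esub> lamU (v i) \<otimes>\<^bsub>U\<^esub> ?t)"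
        using t by (intro U.A.finsum_ldistr) (auto simp: yc lamU vi)
      also have "\<dots> \<in> T"
      proof (rule U.A.finsum_induct[where P = "\<lambda>u. u \<in> T"])
        fix i assume "i \<in> {..<n}"
        then show "y i \<otimes>\<^bsub>U\<^esub> lamU (v i) \<otimes>\<^bsub>U\<^esub> ?t \<in> T"
          using y_T[of i] lam[OF vi r] t by (simp add: U.A.m_assoc[OF yc lamU t] vi)
      qed (use t in \<open>auto simp: yc lamU vi T_zero T_add\<close>)
      finally show "j m \<otimes>\<^bsub>U\<^esub> ?t \<in> T"
        using T_add lam[OF sv(2) r] sv t sum
        by (simp add: j_decomp U.A.l_distr lamU)
    qed
    {
      case Nil
      have "lamU s \<otimes>\<^bsub>U\<^esub> (W [] \<otimes>\<^bsub>U\<^esub> lamU r) \<in> T" if "s \<in> carrier R" "r \<in> carrier R" for s r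
        using that T_word[of "[]" "s \<otimes> r"] by (simp add: W_def word_prod_def lamU lamU_mult)
      then show ?case by (rule step)
    next
      case (Cons a ws)
      then obtain i where a: "i < n" "a = x i" by auto
      have "lamU s \<otimes>\<^bsub>U\<^esub> (W (a # ws) \<otimes>\<^bsub>U\<^esub> lamU r) \<in> T" if sr: "s \<in> carrier R" "r \<in> carrier R" for s r
      proof -
        \<comment> \<open>The product of \<open>lamU s\<close> and \<open>y i\<close> is the value
          of \<open>j\<close> at this element, to which the induction hypothesis for
          \<open>ws\<close> applies.\<close>
        have "lsmult M s (\<zero>, unit_col R n i) \<in> carrier M"
          using sr by (auto simp: M unit_col_closed der_closed tau_closed)
        then have "lamU s \<otimes>\<^bsub>U\<^esub> y i \<otimes>\<^bsub>U\<^esub> (W ws \<otimes>\<^bsub>U\<^esub> lamU r) \<in> T"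
          unfolding y_def j_lsmult[OF e sr(1), symmetric] using Cons sr by simp
        moreover have "W (a # ws) = y i \<otimes>\<^bsub>U\<^esub> W ws"
          using a by (simp add: W_def word_prod_def q_x)
        ultimately show ?thesis
          using sr by (simp add: U.A.m_assoc yc Wc lamU)
      qed
      then show ?case by (rule step)
    }
  qed

  \<comment> \<open>Surjectivity of \<open>g\<close> and bijectivity of \<open>h\<close>\<close>
  have T_neg: "\<ominus>\<^bsub>U\<^esub> t \<in> T" if t: "t \<in> T" for t
  proof -
    obtain s where s: "s \<in> carrier S" and t_eq: "t = g s"
      using t by (auto simp: T_def)
    have "g (\<ominus>\<^bsub>S\<^esub> s) \<oplus>\<^bsub>U\<^esub> g s = \<zero>\<^bsub>U\<^esub>"
      using s g_add[of "\<ominus>\<^bsub>S\<^esub> s" s] by (simp add: S.A.l_neg g_zero)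
    then have "\<ominus>\<^bsub>U\<^esub> t = g (\<ominus>\<^bsub>S\<^esub> s)"
      using s by (simp add: t_eq U.A.minus_equality g_closed)
    then show ?thesis
      using s by (simp add: T_def)
  qed
  \<comment> \<open>The elements whose left multiplication preserves \<open>T\<close>. They form a
    subring containing the image of \<open>j\<close>, which generates \<open>U\<close>, so
    \<open>H\<close> is all of \<open>U\<close>.\<close>
  define H where "H = {u \<in> carrier U. \<forall>t\<in>T. u \<otimes>\<^bsub>U\<^esub> t \<in> T}"
  have "subring H U"
  proof (rule U.A.subringI)
    fix u v assume "u \<in> H" "v \<in> H"
    then show "u \<otimes>\<^bsub>U\<^esub> v \<in> H" "u \<oplus>\<^bsub>U\<^esub> v \<in> H"
      using TU T_add by (auto simp: H_def U.A.m_assoc U.A.l_distr subset_iff)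
  qed (use TU T_neg in \<open>auto simp: H_def U.A.l_minus subset_iff\<close>)
  moreover have "j ` carrier M \<subseteq> H"
  proof (rule image_subsetI)
    fix m assume m: "m \<in> carrier M"
    have "j m \<otimes>\<^bsub>U\<^esub> t \<in> T" if "t \<in> T" for t
      by (rule T_induct[OF j_closed[OF m] that]) (use j_word m in blast)
    with m show "j m \<in> H"
      by (simp add: H_def j_closed)
  qed
  moreover have "rank1_incl ?V \<in> carrier R \<rightarrow> carrier M"
    by (auto simp: rank1_incl_def M)
  ultimately have H: "H = carrier U"
    using universal_R_ring_generated[OF U(1)] by blast
  \<comment> \<open>The empty word puts the identity into \<open>T\<close>, and then every
    \<open>u\<close> is in \<open>T\<close> as \<open>u\<close> times the identity.\<close>
  have T_one: "\<one>\<^bsub>U\<^esub> \<in> T"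
    using T_word[of "[]" \<one>] by (simp add: W_def word_prod_def lamU_one)
  have "u \<in> T" if u: "u \<in> carrier U" for u
  proof -
    have "u \<in> H"
      by (simp add: H u)
    then have "u \<otimes>\<^bsub>U\<^esub> \<one>\<^bsub>U\<^esub> \<in> T"
      using T_one unfolding H_def by blast
    then show ?thesis
      by (simp add: u)
  qed
  \<comment> \<open>Write \<open>u = g s\<close>; then \<open>h_g\<close> gives
    \<open>h u = s\<close>, so \<open>g\<close> is a two-sided inverse of \<open>h\<close>.\<close>
  then have g_h: "g (h u) = u" if "u \<in> carrier U" for u
    using that h_g by (force simp: T_def)
  have "bij_betw h (carrier U) (carrier S)"
    using ring_hom_closed[OF h_hom] g_closed g_h h_g
    by (intro bij_betw_byWitness[where f' = g]) auto
  then have iso: "R_ring_isomorphic R U lamU S lamS"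
    using h unfolding R_ring_isomorphic_def by blast
  show ?thesis
    using lamU by (intro R_ring_isomorphic_sym[OF U.A.ring_axioms _ iso])
qed

end

text \<open>If \<open>R\<close> is the zero ring, so is \<open>S\<close>, and the words
  \<open>[x 0]\<close> and \<open>[]\<close> have the same product, against freeness of the
  submonoid. The letter \<open>x 0\<close> is available because \<open>n > 0\<close>.\<close>

lemma free_skew_extension_one_neq_zero:
  assumes ext: "free_skew_extension R n \<sigma> \<delta> S lamS x" and n: "n > 0"
  shows "\<one>\<^bsub>R\<^esub> \<noteq> \<zero>\<^bsub>R\<^esub>"
proof
  assume eq: "\<one>\<^bsub>R\<^esub> = \<zero>\<^bsub>R\<^esub>"
  have S: "R_ring R S lamS" and x: "x 0 \<in> carrier S"
    and inj: "inj_on (word_prod S) (lists (x ` {..<n}))"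
    using ext n by (auto simp: free_skew_extension_def free_submonoid_on_def bij_betw_def)
  interpret S: R_ring R S lamS by (rule S)
  have "\<one>\<^bsub>S\<^esub> = \<zero>\<^bsub>S\<^esub>"
    using ring_hom_one[OF S.lam_hom] ring_hom_zero[OF S.lam_hom S.R.ring_axioms S.A.ring_axioms] eq by simp
  then have "word_prod S [x 0] = word_prod S []"
    using S.A.r_null[OF x] by (simp add: word_prod_def)
  moreover have "[x 0] \<in> lists (x ` {..<n})" "[] \<in> lists (x ` {..<n})"
    using n by auto
  ultimately show False
    using inj by (auto dest: inj_onD)
qed

theorem corollary2p4:
  fixes R :: "('r, 'k) ring_scheme" and n :: nat
    and \<sigma> :: "'r \<Rightarrow> nat \<Rightarrow> nat \<Rightarrow> 'r" and \<delta> :: "'r \<Rightarrow> nat \<Rightarrow> 'r"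
    and S :: "('s, 'l) ring_scheme" and lamS :: "'r \<Rightarrow> 's" and x :: "nat \<Rightarrow> 's"
  assumes "ring R"
    and "n > 0"
    and "\<sigma> \<in> ring_hom R (mat_ring R n)"
    and "right_sigma_derivation R n \<sigma> \<delta>"
    and "free_skew_extension R n \<sigma> \<delta> S lamS x"
  shows "\<exists>(V :: ('r, nat \<Rightarrow> 'r) rmodule) \<tau> d.
    free_right_module R V n \<and>
    \<tau> \<in> ring_hom R (End_ring R V) \<and>
    tau_derivation R V \<tau> d \<and>
    R_ring_isomorphic R S lamS
      (univ_ring R (rank1_ext R V \<tau> d) (rank1_incl V))
      (univ_lam R (rank1_ext R V \<tau> d) (rank1_incl V))"
proof -
  interpret skew_derivation R n \<sigma> \<delta>
    using assms by (intro skew_derivation.intro skew_derivation_axioms.intro)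
  \<comment> \<open>The type of test rings stays schematic here; below it is instantiated once with
    the type of the universal ring and once with that of \<open>S\<close>.\<close>
  note universal = univ_ring_rank1_ext_universal[OF col_module_right_module tau_ring_hom der_tau_derivation]
  show ?thesis
    using free_right_module_col_module[OF free_skew_extension_one_neq_zero[OF assms(5,2)]]
      tau_ring_hom der_tau_derivation skew_extension_isomorphic_universal[OF assms(5) universal universal]
    by blast
qed

end
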